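(* For every integer $g \geq 2$ there is a gpnf-action of a finite group of order $4g$ on a closed orientable surface of genus $g$. In particular $\mu(g) \geq 4g$ for every odd $g\geq 3$.
   Context: A continuous (faithful) action of a finite group $G$ by orientation-preserving homeomorphisms on a closed orientable surface $X$ is called a gpnf-action if every element of $G$ has a fixed point on $X$; its order is $|G|$. For $g\geq 2$, $\mu(g)$ denotes the largest order of a gpnf-action on a closed orientable surface of genus $g$. *)

theory Defs
  imports "HOL-Analysis.Analysis" "HOL-Homology.Homology" "HOL-Algebra.Free_Abelian_Groups"
begin

definition locally_euclidean_2 :: "'a topology \<Rightarrow> bool" where
  "locally_euclidean_2 X \<longleftrightarrow>
     (\<forall>x\<in>topspace X. \<exists>U. openin X U \<and> x \<in> U \<and>
        (\<exists>V::(real^2) set. open V \<and> subtopology X U homeomorphic_space top_of_set V))"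

text \<open>Closed orientable surface of genus g: a compact connected Hausdorff
  2-manifold which is orientable (second homology infinite cyclic) and whose
  first homology is free abelian of rank 2g.\<close>
definition closed_orientable_surface :: "'a topology \<Rightarrow> nat \<Rightarrow> bool" where
  "closed_orientable_surface X g \<longleftrightarrow>
     Hausdorff_space X \<and> compact_space X \<and> connected_space X \<and> topspace X \<noteq> {} \<and>
     locally_euclidean_2 X \<and>
     homology_group 2 X \<cong> integer_group \<and>
     homology_group 1 X \<cong> free_Abelian_group {..<2*g}"

definition orientation_preserving_homeo :: "'a topology \<Rightarrow> ('a \<Rightarrow> 'a) \<Rightarrow> bool" where
  "orientation_preserving_homeo X f \<longleftrightarrow>
     homeomorphic_map X X f \<and>
     (\<forall>c\<in>carrier (homology_group 2 X). hom_induced 2 X {} X {} f c = c)"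

definition orient_pres_faithful_action ::
    "('g, 'b) monoid_scheme \<Rightarrow> 'a topology \<Rightarrow> ('g \<Rightarrow> 'a \<Rightarrow> 'a) \<Rightarrow> bool" where
  "orient_pres_faithful_action G X \<phi> \<longleftrightarrow>
     group G \<and>
     (\<forall>h\<in>carrier G. orientation_preserving_homeo X (\<phi> h)) \<and>
     (\<forall>x\<in>topspace X. \<phi> \<one>\<^bsub>G\<^esub> x = x) \<and>
     (\<forall>h\<in>carrier G. \<forall>k\<in>carrier G. \<forall>x\<in>topspace X.
        \<phi> (h \<otimes>\<^bsub>G\<^esub> k) x = \<phi> h (\<phi> k x)) \<and>
     (\<forall>h\<in>carrier G. (\<forall>x\<in>topspace X. \<phi> h x = x) \<longrightarrow> h = \<one>\<^bsub>G\<^esub>)"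

definition gpnf_action ::
    "('g, 'b) monoid_scheme \<Rightarrow> 'a topology \<Rightarrow> ('g \<Rightarrow> 'a \<Rightarrow> 'a) \<Rightarrow> bool" where
  "gpnf_action G X \<phi> \<longleftrightarrow>
     finite (carrier G) \<and> orient_pres_faithful_action G X \<phi> \<and>
     (\<forall>h\<in>carrier G. \<exists>x\<in>topspace X. \<phi> h x = x)"

end

theory Submission
  imports Defs "HOL-Complex_Analysis.Conformal_Mappings"
begin

text \<open>
  The surface is the one-point compactification of the affine curve
  \<open>y\<^sup>2 = x (x\<^bsup>2g\<^esup> - 1)\<close>, on which a \<open>4g\<close>-th root of unity \<open>c\<close> acts by
  \<open>(x, y) \<mapsto> (c\<^sup>2 x, c y)\<close>; every element fixes \<open>(0, 0)\<close>, and near infinity it is a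
  rotation of a disc.

  Cutting the curve along \<open>x\<^bsup>2g\<^esup> \<ge> 1\<close> leaves a contractible set, and the cuts have a
  neighbourhood consisting of \<open>2g\<close> bands, each crossed by its cut; so \<open>H\<^sub>1\<close> of the curve is free of rank
  \<open>2g\<close> and \<open>H\<^sub>2\<close> vanishes.  The involution \<open>y \<mapsto> -y\<close> swaps the two sides of every cut and hence is
  \<open>-1\<close> on \<open>H\<^sub>1\<close> of the curve, but it is the identity on the local homology at infinity, being
  homotopic to the identity there.  As \<open>H\<^sub>1\<close> of the curve is torsion-free, the boundary map from
  the local homology to it is zero, which gives the homology of the surface.  Finally \<open>H\<^sub>2\<close> of the
  surface embeds into the local homology at infinity, where all rotations act trivially, so the
  action preserves the orientation.
\<close>

section \<open>Homology of covers by a contractible set and a two-sided set\<close>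

text \<open>The polynomial in x has 2g+1 distinct zeros, an odd number, which gives genus g with a
  single point at infinity. The rotations of x have order dividing 2g; lifting them to y doubles
  this to 4g, with c = -1 acting as the hyperelliptic involution. The group is cyclic with a common
  fixed point, so the fixed-point condition is immediate. The effort goes elsewhere: genus and
  orientation are defined through singular homology, so \<open>H\<^sub>1\<close>,
  \<open>H\<^sub>2\<close> and the action on \<open>H\<^sub>2\<close> must be derived from
  exactness, excision and homotopy invariance. This shapes the cutting: the cuts are the places
  where the principal root of 1 - x^(2g) jumps, so that explicit formulas identify the rest with a
  star-shaped plane set and the bands with copies of one. The delicate point is the boundary map at
  infinity. Geometrically the loop around infinity is a product of commutators in the curve; the
  sign argument with the involution shows that its class vanishes without following the loop through
  the bands. The bound on \<mu> follows from existence, \<mu>(g) being a maximum.\<close>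

lemma trivial_relative_homology_group_iso_inclusion:
  assumes "\<And>p. hom_induced p (subtopology X S) {} X {} id
                 \<in> iso (homology_group p (subtopology X S)) (homology_group p X)"
  shows "trivial_group (relative_homology_group p X S)"
proof (rule exact_seq_imp_triviality)
  show "exact_seq ([homology_group (p-1) X,
                    homology_group (p-1) (subtopology X S),
                    relative_homology_group p X S, homology_group p X, homology_group p (subtopology X S)],
                   [hom_induced (p-1) (subtopology X S) {} X {} id,
                    hom_boundary p X S,
                    hom_induced p X {} X S id,
                    hom_induced p (subtopology X S) {} X {} id])"
    using homology_exactness_axiom_1 homology_exactness_axiom_2 homology_exactness_axiom_3
    by (metis exact_seq_cons_iff)
qed (use assms in auto)

text \<open>The model is a product of a space with an open interval, \<open>P\<close> and
  \<open>M\<close> being the two ends. In the sequence of the triple \<open>P\<close>,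
  \<open>P \<union> M\<close>, \<open>X\<close> the groups of \<open>X\<close> relative to
  \<open>P\<close> vanish, so the boundary is an isomorphism onto the homology of
  \<open>P \<union> M\<close> relative to \<open>P\<close>. Excising \<open>P\<close> leaves the
  homology of \<open>M\<close>, which is that of \<open>X\<close>, one degree lower.\<close>

lemma isomorphic_relative_homology_group_two_sides:
  assumes P: "openin X P" and M: "openin X M" and disj: "disjnt P M"
    and isoP: "\<And>p. hom_induced p (subtopology X P) {} X {} id
                 \<in> iso (homology_group p (subtopology X P)) (homology_group p X)"
    and isoM: "\<And>p. hom_induced p (subtopology X M) {} X {} id
                 \<in> iso (homology_group p (subtopology X M)) (homology_group p X)"
  shows "relative_homology_group p X (P \<union> M) \<cong> homology_group (p - 1) X"
proof -
  let ?Y = "subtopology X (P \<union> M)"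
  have triv: "trivial_group (relative_homology_group q X P)" for q
    by (rule trivial_relative_homology_group_iso_inclusion [OF isoP])
  have "hom_relboundary p X (P \<union> M) P
         \<in> iso (relative_homology_group p X (P \<union> M)) (relative_homology_group (p - 1) ?Y P)"
  proof (rule very_short_exact_sequence)
    show "exact_seq
         ([relative_homology_group (p - 1) X P, relative_homology_group (p - 1) ?Y P, relative_homology_group p X (P \<union> M), relative_homology_group p X P],
          [hom_induced (p - 1) ?Y P X P id, hom_relboundary p X (P \<union> M) P, hom_induced p X P X (P \<union> M) id])"
      using homology_exactness_triple_1 [of P "P \<union> M"] homology_exactness_triple_2 [of P "P \<union> M"] by simp
  qed (use triv in auto)
  then have 1: "relative_homology_group p X (P \<union> M) \<cong> relative_homology_group (p - 1) ?Y P"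
    by (rule is_isoI)
  have PY: "openin ?Y P" "openin ?Y M"
    using P M by (auto simp: openin_open_subtopology openin_Un)
  have tY: "topspace ?Y = P \<union> M"
    using P M openin_subset by fastforce
  have clP: "closedin ?Y P"
    unfolding closedin_def tY using PY disj
    by (metis Diff_cancel Diff_triv Un_Diff disjnt_def disjnt_sym inf_commute sup_bot.left_neutral sup_ge1)
  have sub: "P \<union> M - P = M" using disj by (auto simp: disjnt_def)
  \<comment> \<open>\<open>P\<close> is both open and closed in \<open>P \<union> M\<close>, so it
    may be excised entirely.\<close>
  have "hom_induced (p-1) (subtopology ?Y (P \<union> M - P)) (P - P) (subtopology ?Y (P \<union> M)) P id
      \<in> iso (relative_homology_group (p-1) (subtopology ?Y (P \<union> M - P)) (P - P))
          (relative_homology_group (p-1) (subtopology ?Y (P \<union> M)) P)"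
    by (rule homology_excision_axiom) (use PY clP in \<open>auto simp: closure_of_closedin interior_of_openin\<close>)
  moreover have "subtopology ?Y (P \<union> M - P) = subtopology X M"
    unfolding sub by (simp add: subtopology_subtopology Int_absorb1)
  moreover have "subtopology ?Y (P \<union> M) = ?Y" by (simp add: subtopology_subtopology)
  ultimately have 2: "homology_group (p - 1) (subtopology X M) \<cong> relative_homology_group (p - 1) ?Y P"
    by (metis Diff_cancel is_isoI)
  have 3: "homology_group (p - 1) (subtopology X M) \<cong> homology_group (p - 1) X"
    by (rule is_isoI [OF isoM])
  have "relative_homology_group (p - 1) ?Y P \<cong> homology_group (p - 1) (subtopology X M)"
    by (rule group.iso_sym [OF _ 2]) simp
  then show ?thesis
    by (meson 1 3 iso_trans)
qed

lemma hom_induced_inclusion_square: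
  assumes f: "continuous_map X X f" and "S \<subseteq> T" "f \<in> S \<rightarrow> S'" "f \<in> T \<rightarrow> T'" "S' \<subseteq> T'"
  shows "hom_induced p (subtopology X T) {} (subtopology X T') {} f (hom_induced p (subtopology X S) {} (subtopology X T) {} id c)
       = hom_induced p (subtopology X S') {} (subtopology X T') {} id (hom_induced p (subtopology X S) {} (subtopology X S') {} f c)"
proof -
  have "continuous_map (subtopology X T) (subtopology X T') f"
    "continuous_map (subtopology X S) (subtopology X S') f"
    "continuous_map (subtopology X S) (subtopology X T) id"
    "continuous_map (subtopology X S') (subtopology X T') id"
    using assms 
    by (auto simp: continuous_map_in_subtopology continuous_map_from_subtopology continuous_map_id_subt)
  then show ?thesis
    by (simp add: hom_induced_compose')
qed

text \<open>The boundary of a relative class is a pair of classes on the two sides that cancel in \<open>X\<close>;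
  as \<open>f\<close> acts trivially on \<open>X\<close>, exchanging the sides negates the pair.\<close>

lemma hom_induced_swap_two_sides:
  assumes P: "openin X P" and M: "openin X M" and disj: "disjnt P M"
    and isoP: "\<And>p. hom_induced p (subtopology X P) {} X {} id
                 \<in> iso (homology_group p (subtopology X P)) (homology_group p X)"
    and isoM: "\<And>p. hom_induced p (subtopology X M) {} X {} id
                 \<in> iso (homology_group p (subtopology X M)) (homology_group p X)"
    and f: "continuous_map X X f" and fPM: "f \<in> P \<rightarrow> M" and fMP: "f \<in> M \<rightarrow> P"
    and f_id: "\<And>c. c \<in> carrier (homology_group (p-1) X) \<Longrightarrow> hom_induced (p-1) X {} X {} f c = c"
    and c: "c \<in> carrier (relative_homology_group p X (P \<union> M))"
  shows "hom_induced p X (P \<union> M) X (P \<union> M) f c = inv\<^bsub>relative_homology_group p X (P \<union> M)\<^esub> c"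
proof -
  let ?q = "p - 1"
  let ?Y = "subtopology X (P \<union> M)"
  let ?R = "relative_homology_group p X (P \<union> M)"
  let ?HY = "homology_group ?q ?Y"
  let ?HX = "homology_group ?q X"
  let ?HP = "homology_group ?q (subtopology X P)"
  let ?HM = "homology_group ?q (subtopology X M)"
  let ?iP = "hom_induced ?q (subtopology X P) {} ?Y {} id"
  let ?iM = "hom_induced ?q (subtopology X M) {} ?Y {} id"
  let ?jP = "hom_induced ?q (subtopology X P) {} X {} id"
  let ?jM = "hom_induced ?q (subtopology X M) {} X {} id"
  let ?j = "hom_induced ?q ?Y {} X {} id"
  let ?F = "hom_induced ?q ?Y {} ?Y {} f"
  let ?a = "hom_induced ?q (subtopology X P) {} (subtopology X M) {} f"
  let ?b = "hom_induced ?q (subtopology X M) {} (subtopology X P) {} f"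
  let ?d = "hom_boundary p X (P \<union> M)"
  interpret R: comm_group ?R by simp
  interpret HY: comm_group ?HY by simp
  interpret HX: comm_group ?HX by simp
  interpret HP: comm_group ?HP by simp
  interpret HM: comm_group ?HM by simp
  interpret iP: group_hom ?HP ?HY ?iP by unfold_locales (rule hom_induced_hom)
  interpret iM: group_hom ?HM ?HY ?iM by unfold_locales (rule hom_induced_hom)
  interpret jP: group_hom ?HP ?HX ?jP by unfold_locales (rule hom_induced_hom)
  interpret jM: group_hom ?HM ?HX ?jM by unfold_locales (rule hom_induced_hom)
  interpret inc: group_hom ?HY ?HX ?j by unfold_locales (rule hom_induced_hom)
  interpret F: group_hom ?HY ?HY ?F by unfold_locales (rule hom_induced_hom)
  interpret d: group_hom ?R ?HY ?d by unfold_locales (rule hom_boundary_hom)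
  have ji: "?j (?iP x) = ?jP x" "?j (?iM y) = ?jM y" for x y
    by (subst hom_induced_compose'; simp add: continuous_map_id_subt continuous_map_in_subtopology continuous_map_from_subtopology; fail)+
  \<comment> \<open>The homology of \<open>P \<union> M\<close> maps onto that of \<open>X\<close>,
    because that of \<open>P\<close> alone does; by exactness the next map is zero and the boundary
    is injective.\<close>
  have inj: "inj_on ?d (carrier ?R)"
  proof -
    have ex: "exact_seq ([homology_group (p-1) ?Y, ?R, homology_group p X, homology_group p ?Y],
                   [?d, hom_induced p X {} X (P \<union> M) id, hom_induced p ?Y {} X {} id])"
      using homology_exactness_axiom_1 [of p X "P \<union> M"] homology_exactness_axiom_3 [of p X "P \<union> M"]
      by (metis exact_seq_cons_iff)
    have "hom_induced p ?Y {} X {} id ` carrier (homology_group p ?Y) = carrier (homology_group p X)"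
    proof
      show "hom_induced p ?Y {} X {} id ` carrier (homology_group p ?Y) \<subseteq> carrier (homology_group p X)"
        by (auto simp: hom_induced_carrier)
      show "carrier (homology_group p X) \<subseteq> hom_induced p ?Y {} X {} id ` carrier (homology_group p ?Y)"
      proof
        fix x assume "x \<in> carrier (homology_group p X)"
        then obtain y where "x = hom_induced p (subtopology X P) {} X {} id y"
          using isoP [of p] by (auto simp: iso_def bij_betw_def)
        also have "\<dots> = hom_induced p ?Y {} X {} id (hom_induced p (subtopology X P) {} ?Y {} id y)"
          by (subst hom_induced_compose'; simp add: continuous_map_id_subt continuous_map_in_subtopology continuous_map_from_subtopology)
        finally show "x \<in> hom_induced p ?Y {} X {} id ` carrier (homology_group p ?Y)"
          using hom_induced_carrier by (rule image_eqI)
      qed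
    qed
    then show ?thesis
      using exact_seq_mon_eq_triviality [OF ex] exact_seq_epi_eq_triviality [OF ex] by blast
  qed
  have PY: "openin ?Y P" "openin ?Y M"
    using P M by (auto simp: openin_open_subtopology openin_Un)
  have tY: "topspace ?Y = P \<union> M"
    using P M openin_subset by fastforce
  have subs: "subtopology ?Y P = subtopology X P" "subtopology ?Y M = subtopology X M"
    by (simp_all add: subtopology_subtopology Int_absorb1)
  have dc: "?d c \<in> carrier ?HY" using c by simp
  moreover have "(\<lambda>(a,b). ?iP a \<otimes>\<^bsub>?HY\<^esub> ?iM b) \<in> iso (?HP \<times>\<times> ?HM) ?HY"
    using homology_additivity_explicit [OF PY disj, of ?q] tY unfolding subs by simp
  then have "carrier ?HY = (\<lambda>(a,b). ?iP a \<otimes>\<^bsub>?HY\<^esub> ?iM b) ` (carrier ?HP \<times> carrier ?HM)"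
    by (simp add: iso_def bij_betw_def)
  ultimately have "?d c \<in> (\<lambda>(a,b). ?iP a \<otimes>\<^bsub>?HY\<^esub> ?iM b) ` (carrier ?HP \<times> carrier ?HM)"
    by (simp only:)
  then obtain x y where x: "x \<in> carrier ?HP" and y: "y \<in> carrier ?HM"
    and dxy: "?d c = ?iP x \<otimes>\<^bsub>?HY\<^esub> ?iM y"
    by (elim imageE SigmaE) simp
  have "?j (?d c) = \<one>\<^bsub>?HX\<^esub>"
    using homology_exactness_axiom_2 [of p X "P \<union> M"] c
    by (simp add: kernel_def set_eq_iff image_iff) blast
  then have jxy: "?jP x \<otimes>\<^bsub>?HX\<^esub> ?jM y = \<one>\<^bsub>?HX\<^esub>"
    using x y dxy ji by simp
  have contf: "continuous_map ?Y ?Y f" 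
    using f fPM fMP by (auto simp: continuous_map_in_subtopology continuous_map_from_subtopology)
  have fU: "f \<in> P \<union> M \<rightarrow> P \<union> M" using fPM fMP by auto
  have Fi: "?F (?iP x) = ?iM (?a x)" "?F (?iM y) = ?iP (?b y)"
    by (rule hom_induced_inclusion_square [OF f]; use fPM fMP fU in simp)+
  have fj: "?jM (?a x) = ?jP x" "?jP (?b y) = ?jM y"
    using hom_induced_inclusion_square [of X f P UNIV M UNIV ?q x] 
      hom_induced_inclusion_square [of X f M UNIV P UNIV ?q y] f fPM fMP
    by (simp_all add: f_id x y)
  have ax: "?a x \<in> carrier ?HM" and bY: "?b y \<in> carrier ?HP"
    by (simp_all add: hom_induced_carrier)
  have injP: "inj_on ?jP (carrier ?HP)" and injM: "inj_on ?jM (carrier ?HM)"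
    using isoP isoM by (auto simp: iso_def bij_betw_def)
  \<comment> \<open>As \<open>f\<close> is trivial on the homology of \<open>X\<close>, the class
    \<open>?b y\<close> has the same image there as \<open>y\<close>. So the images of
    \<open>x\<close> and \<open>?b y\<close> cancel in \<open>X\<close>, hence already in
    \<open>P\<close>; the same holds with the sides exchanged.\<close>
  have "?jP (x \<otimes>\<^bsub>?HP\<^esub> ?b y) = \<one>\<^bsub>?HX\<^esub>"
    using x bY by (simp add: fj jxy)
  then have xb: "x \<otimes>\<^bsub>?HP\<^esub> ?b y = \<one>\<^bsub>?HP\<^esub>"
    using injP x bY by (metis HP.m_closed HP.one_closed inj_onD jP.hom_one)
  have "?jM (?a x \<otimes>\<^bsub>?HM\<^esub> y) = \<one>\<^bsub>?HX\<^esub>"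
    using y ax by (simp add: fj jxy)
  then have ya: "?a x \<otimes>\<^bsub>?HM\<^esub> y = \<one>\<^bsub>?HM\<^esub>"
    using injM y ax by (metis HM.m_closed HM.one_closed inj_onD jM.hom_one)
  let ?fc = "hom_induced p X (P \<union> M) X (P \<union> M) f c"
  have fc: "?fc \<in> carrier ?R" by (simp add: hom_induced_carrier)
  have "?d ?fc = ?F (?d c)"
    using naturality_hom_induced [OF f fU, of p] by (metis comp_apply)
  also have "\<dots> = ?iM (?a x) \<otimes>\<^bsub>?HY\<^esub> ?iP (?b y)"
    using x y by (simp add: dxy Fi)
  finally have "?d (?fc \<otimes>\<^bsub>?R\<^esub> c) = (?iM (?a x) \<otimes>\<^bsub>?HY\<^esub> ?iP (?b y)) \<otimes>\<^bsub>?HY\<^esub> (?iP x \<otimes>\<^bsub>?HY\<^esub> ?iM y)"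
    using c fc dxy by simp
  also have "\<dots> = ?iP (x \<otimes>\<^bsub>?HP\<^esub> ?b y) \<otimes>\<^bsub>?HY\<^esub> ?iM (?a x \<otimes>\<^bsub>?HM\<^esub> y)"
    using x y ax bY by (simp add: HY.m_ac)
  also have "\<dots> = \<one>\<^bsub>?HY\<^esub>" by (simp add: xb ya)
  finally have "?fc \<otimes>\<^bsub>?R\<^esub> c = \<one>\<^bsub>?R\<^esub>"
    using inj c fc by (metis R.m_closed R.one_closed inj_onD d.hom_one)
  then show ?thesis
    using R.inv_equality c fc by metis
qed

text \<open>The excised set is the complement of \<open>N\<close>: it is closed, and it lies in the
  open set \<open>V\<close> because the two sets cover.\<close>

lemma iso_hom_induced_excision_cover:
  assumes V: "openin X V" and N: "openin X N" and VN: "V \<union> N = topspace X"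
  shows "hom_induced p (subtopology X N) (V \<inter> N) X V id
         \<in> iso (relative_homology_group p (subtopology X N) (V \<inter> N)) (relative_homology_group p X V)"
proof -
  let ?U = "topspace X - N"
  have "X closure_of ?U \<subseteq> X interior_of V"
  proof -
    have "closedin X ?U" using N by blast
    then show ?thesis using V VN by (auto simp: closure_of_closedin interior_of_openin)
  qed
  moreover have "topspace X - ?U = N" "V - ?U = V \<inter> N"
    using openin_subset [OF N] openin_subset [OF V] by auto
  ultimately show ?thesis
    using homology_excision_axiom [of X ?U V "topspace X" p] openin_subset [OF V] by simp
qed

text \<open>The picture: \<open>V\<close> is the space cut open, \<open>N\<close> a neighbourhood of
  the cuts, \<open>P\<close> and \<open>M\<close> the two banks of the cuts inside \<open>N\<close>.
  The isomorphisms say that each bank carries the homology of the whole neighbourhood. The setting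
  is used for the affine curve and for the punctured disc.\<close>

context
  fixes X :: "'a topology" and V N P M :: "'a set"
  assumes V: "openin X V" and N: "openin X N" and VN: "V \<union> N = topspace X"
    and contr: "contractible_space (subtopology X V)" and ne: "V \<noteq> {}"
    and PM: "V \<inter> N = P \<union> M" and P: "openin X P" and M: "openin X M" and disj: "disjnt P M"
    and isoP: "\<And>p. hom_induced p (subtopology X P) {} (subtopology X N) {} id
                 \<in> iso (homology_group p (subtopology X P)) (homology_group p (subtopology X N))"
    and isoM: "\<And>p. hom_induced p (subtopology X M) {} (subtopology X N) {} id
                 \<in> iso (homology_group p (subtopology X M)) (homology_group p (subtopology X N))"
begin

lemma two_sided_cover_side_facts:
  shows "openin (subtopology X N) P" "openin (subtopology X N) M"
    "subtopology (subtopology X N) P = subtopology X P"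
    "subtopology (subtopology X N) M = subtopology X M"
proof -
  have "P \<subseteq> N" "M \<subseteq> N" using PM by auto
  then show "openin (subtopology X N) P" "openin (subtopology X N) M"
    "subtopology (subtopology X N) P = subtopology X P"
    "subtopology (subtopology X N) M = subtopology X M"
    using P M N by (auto simp: openin_open_subtopology subtopology_subtopology Int_absorb1)
qed

lemma iso_reduced_homology_two_sided_cover:
  "hom_induced p X {} X V id \<in> iso (reduced_homology_group p X) (relative_homology_group p X V)"
  using contr ne openin_subset [OF V] by (intro iso_reduced_homology_by_contractible) auto

text \<open>Contracting \<open>V\<close> turns reduced homology into homology relative to
  \<open>V\<close>, and excision turns this into homology of \<open>N\<close> relative to its two
  banks. Homologically the space is thus a reduced suspension of \<open>N\<close> with a disjoint
  base point added.\<close>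

proposition isomorphic_reduced_homology_two_sided_cover:
  "reduced_homology_group p X \<cong> homology_group (p - 1) (subtopology X N)"
proof -
  have "relative_homology_group p (subtopology X N) (P \<union> M) \<cong> homology_group (p - 1) (subtopology X N)"
    using isomorphic_relative_homology_group_two_sides [of "subtopology X N" P M p]
      two_sided_cover_side_facts disj isoP isoM by simp
  moreover have "relative_homology_group p (subtopology X N) (P \<union> M) \<cong> relative_homology_group p X V"
    using iso_hom_induced_excision_cover [OF V N VN, of p] unfolding PM by (rule is_isoI)
  then have "relative_homology_group p X V \<cong> relative_homology_group p (subtopology X N) (P \<union> M)"
    by (rule group.iso_sym [rotated]) simp
  moreover have "reduced_homology_group p X \<cong> relative_homology_group p X V"
    by (rule is_isoI [OF iso_reduced_homology_two_sided_cover])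
  ultimately show ?thesis
    by (meson iso_trans)
qed

text \<open>The isomorphisms behind the computation of the homology are induced by inclusions, and
  \<open>f\<close> respects both \<open>V\<close> and \<open>N\<close>. So the sign found on the
  relative homology of \<open>N\<close> carries over.\<close>

proposition hom_induced_swap_two_sided_cover:
  assumes f: "continuous_map X X f" and fV: "f \<in> V \<rightarrow> V" and fN: "f \<in> N \<rightarrow> N"
    and fPM: "f \<in> P \<rightarrow> M" and fMP: "f \<in> M \<rightarrow> P"
    and f_id: "\<And>c. c \<in> carrier (homology_group (p-1) (subtopology X N)) \<Longrightarrow>
                 hom_induced (p-1) (subtopology X N) {} (subtopology X N) {} f c = c"
    and c: "c \<in> carrier (reduced_homology_group p X)"
  shows "hom_induced p X {} X {} f c = inv\<^bsub>homology_group p X\<^esub> c"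
proof -
  let ?N = "subtopology X N"
  let ?G = "homology_group p X"
  let ?R = "relative_homology_group p ?N (P \<union> M)"
  let ?S = "relative_homology_group p X V"
  let ?e = "hom_induced p ?N (P \<union> M) X V id"
  let ?k = "hom_induced p X {} X V id"
  let ?fc = "hom_induced p X {} X {} f c"
  interpret G: comm_group ?G by simp
  interpret R: comm_group ?R by simp
  interpret S: comm_group ?S by simp
  interpret e: group_hom ?R ?S ?e by unfold_locales (rule hom_induced_hom)
  interpret k: group_hom ?G ?S ?k by unfold_locales (rule hom_induced_hom)
  have cG: "c \<in> carrier ?G"
    using c carrier_reduced_homology_group_subset by auto
  have fN': "continuous_map ?N ?N f"
    using f fN by (auto simp: continuous_map_in_subtopology continuous_map_from_subtopology)
  have fU: "f \<in> P \<union> M \<rightarrow> P \<union> M" using fPM fMP by auto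
  have bij: "bij_betw ?e (carrier ?R) (carrier ?S)"
    using iso_hom_induced_excision_cover [OF V N VN, of p] unfolding PM by (simp add: iso_def)
  have "?k c \<in> carrier ?S" using cG by simp
  then have "?k c \<in> ?e ` carrier ?R" unfolding bij_betw_imp_surj_on [OF bij] .
  then obtain r where r: "r \<in> carrier ?R" and kr: "?k c = ?e r"
    by (elim imageE)
  have idPM: "id \<in> P \<union> M \<rightarrow> V" using equalityD2 [OF PM] by (simp add: subset_iff)
  have "?k ?fc = hom_induced p X V X V f (?k c)"
    using f fV by (simp add: hom_induced_compose')
  also have "\<dots> = ?e (hom_induced p ?N (P \<union> M) ?N (P \<union> M) f r)"
    unfolding kr using f fV fN' fU idPM
    by (simp add: hom_induced_compose')
  also have "hom_induced p ?N (P \<union> M) ?N (P \<union> M) f r = inv\<^bsub>?R\<^esub> r"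
    using hom_induced_swap_two_sides [of ?N P M f p r] two_sided_cover_side_facts disj isoP isoM
      fN' fPM fMP f_id r by simp
  also have "?e (inv\<^bsub>?R\<^esub> r) = ?k (inv\<^bsub>?G\<^esub> c)"
    using r cG kr by simp
  finally have eq: "?k ?fc = ?k (inv\<^bsub>?G\<^esub> c)" .
  \<comment> \<open>The map to relative homology is known to be injective on reduced classes, hence
    the check below that both sides are reduced.\<close>
  have inj: "inj_on ?k (carrier (reduced_homology_group p X))"
    using iso_reduced_homology_two_sided_cover [of p] by (auto simp: iso_def bij_betw_def)
  have "?fc \<in> carrier (reduced_homology_group p X)"
    using c by (rule hom_induced_reduced)
  moreover have "inv\<^bsub>?G\<^esub> c \<in> carrier (reduced_homology_group p X)"
  proof -
    have "subgroup (carrier (reduced_homology_group p X)) ?G"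
      unfolding reduced_homology_group_def
      by (rule G.subgroup_subgroup_generated)
    then show ?thesis using c by (rule subgroup.m_inv_closed)
  qed
  ultimately show ?thesis
    using inj eq by (simp add: inj_on_def)
qed

end

section \<open>Star-shaped fibres and the punctured disc\<close>

text \<open>The straight-line homotopy from \<open>s \<circ> \<rho>\<close> to the identity stays
  inside \<open>A\<close> by \<open>seg\<close>, so \<rho> and \<open>s\<close> are inverse homotopy
  equivalences.\<close>

lemma iso_homology_starlike_fibres:
  fixes A :: "'a::real_normed_vector set" and B :: "'b::topological_space set"
  assumes "continuous_on A \<rho>" "\<rho> \<in> A \<rightarrow> B" "continuous_on B s" "s \<in> B \<rightarrow> A"
    and "\<And>b. b \<in> B \<Longrightarrow> \<rho> (s b) = b"
    and seg: "\<And>a. a \<in> A \<Longrightarrow> closed_segment (s (\<rho> a)) a \<subseteq> A"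
  shows "hom_induced p (top_of_set A) {} (top_of_set B) {} \<rho>
         \<in> iso (homology_group p (top_of_set A)) (homology_group p (top_of_set B))"
proof (rule homotopy_equivalence_homology_group_isomorphism)
  show "continuous_map (top_of_set A) (top_of_set B) \<rho>" "continuous_map (top_of_set B) (top_of_set A) s"
    using assms by auto
  show "homotopic_with_canon (\<lambda>h. True) A A (s \<circ> \<rho>) id"
  proof (rule homotopic_with_linear)
    show "continuous_on A (s \<circ> \<rho>)"
      using assms by (metis continuous_on_compose continuous_on_subset funcset_image)
  qed (use seg in auto)
  show "homotopic_with_canon (\<lambda>h. True) B B (\<rho> \<circ> s) id"
    by (rule homotopic_with_equal) (use assms in auto)
qed

text \<open>Two out of three: the inclusion followed by the projection of \<open>X\<close> is the
  projection of \<open>S\<close>. It makes a band and each of its sides comparable through their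
  common base.\<close>

lemma iso_homology_inclusion_of_projections:
  assumes \<rho>: "continuous_map X B \<rho>"
    and iso: "hom_induced p X {} B {} \<rho> \<in> iso (homology_group p X) (homology_group p B)"
    and isoS: "hom_induced p (subtopology X S) {} B {} \<rho> \<in> iso (homology_group p (subtopology X S)) (homology_group p B)"
  shows "hom_induced p (subtopology X S) {} X {} id \<in> iso (homology_group p (subtopology X S)) (homology_group p X)"
proof -
  let ?f = "hom_induced p (subtopology X S) {} X {} id" 
  let ?g = "hom_induced p X {} B {} \<rho>"
  let ?h = "hom_induced p (subtopology X S) {} B {} \<rho>"
  have gf: "?g (?f x) = ?h x" for x
    by (subst hom_induced_compose') (use \<rho> in \<open>auto simp: continuous_map_id_subt\<close>)
  have g: "bij_betw ?g (carrier (homology_group p X)) (carrier (homology_group p B))"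
   and h: "bij_betw ?h (carrier (homology_group p (subtopology X S))) (carrier (homology_group p B))"
    using iso isoS by (auto simp: iso_def)
  have "bij_betw ?f (carrier (homology_group p (subtopology X S))) (carrier (homology_group p X))"
    unfolding bij_betw_def
  proof (intro conjI equalityI subsetI)
    show "inj_on ?f (carrier (homology_group p (subtopology X S)))"
      using bij_betw_imp_inj_on [OF h] gf by (metis inj_on_def)
  next
    fix y assume y: "y \<in> carrier (homology_group p X)"
    then have "?g y \<in> ?h ` carrier (homology_group p (subtopology X S))"
      unfolding bij_betw_imp_surj_on [OF h] by (simp add: hom_induced_carrier)
    then obtain x where x: "x \<in> carrier (homology_group p (subtopology X S))" "?g y = ?g (?f x)"
      using gf by auto
    then have "y = ?f x"
      using bij_betw_imp_inj_on [OF g] y hom_induced_carrier by (metis inj_on_def)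
    with x(1) show "y \<in> ?f ` carrier (homology_group p (subtopology X S))" by (rule rev_image_eqI)
  qed (auto simp: hom_induced_carrier)
  then show ?thesis by (simp add: iso_def hom_induced_hom)
qed

section \<open>Homology of finite discrete spaces and of the punctured disc\<close>

lemma trivial_homology_discrete_topology:
  assumes "p \<noteq> 0"
  shows "trivial_group (homology_group p (discrete_topology U))"
proof -
  let ?U = "(\<lambda>x. {x}) ` U"
  let ?G = "\<lambda>S. homology_group p (subtopology (discrete_topology U) S)"
  have triv: "trivial_group (?G S)" if "S \<in> ?U" for S
    using that assms homology_dimension_axiom [of "subtopology (discrete_topology U) S"] by fastforce
  have "sum_group ?U ?G \<cong> homology_group p (discrete_topology U)"
    by (rule is_isoI [OF homology_additivity_axiom]) (auto simp: pairwise_def disjnt_def)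
  moreover have "trivial_group (sum_group ?U ?G)"
  proof -
    interpret product: group "product_group ?U ?G" by simp
    have "trivial_group (product_group ?U ?G)"
      using triv by (simp add: trivial_product_group)
    then have "carrier (product_group ?U ?G) = {\<one>\<^bsub>product_group ?U ?G\<^esub>}"
      unfolding trivial_group_def ..
    then show ?thesis
      unfolding sum_group_def by (subst product.trivial_group_subgroup_generated_eq) blast
  qed
  ultimately show ?thesis
    using isomorphic_group_triviality1 by fastforce
qed

lemma top_of_set_finite:
  fixes R :: "'a::metric_space set"
  assumes "finite R"
  shows "top_of_set R = discrete_topology R"
  using assms by (intro subtopology_eq_discrete_topology_finite) (auto simp: Hausdorff_imp_t1_space)

lemma zeroth_homology_discrete_topology:
  assumes "finite R"
  shows "homology_group 0 (discrete_topology R) \<cong> free_Abelian_group {..<card R}"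
proof -
  have "(\<lambda>x. {x}) ` R \<approx> R" by (simp add: inj_on_image_eqpoll_self)
  also have "R \<approx> {..<card R}" using assms by (simp add: eqpoll_iff_card)
  finally have "free_Abelian_group (path_components_of (discrete_topology R)) \<cong> free_Abelian_group {..<card R}"
    by (simp add: isomorphic_free_Abelian_groups)
  with zeroth_homology_group [of "discrete_topology R"] show ?thesis
    by (rule iso_trans)
qed

text \<open>A two-sided cover again: the disc is slit along the non-positive reals, and the left
  half-disc is the neighbourhood of the slit, with its upper and lower quarters as banks. Leaving
  the answer as homology of a point keeps one formula for every degree.\<close>

lemma reduced_homology_punctured_disc:
  "reduced_homology_group p (top_of_set (ball (0::complex) 1 - {0})) \<cong> homology_group (p - 1) (top_of_set {0::complex})"
proof -
  let ?B = "ball (0::complex) 1 - {0}"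
  let ?X = "top_of_set ?B"
  define V where "V = ball (0::complex) 1 - \<real>\<^sub>\<le>\<^sub>0"
  define N where "N = {z \<in> ball (0::complex) 1. Re z < 0}"
  define P where "P = {z \<in> ball (0::complex) 1. Re z < 0 \<and> Im z > 0}"
  define M where "M = {z \<in> ball (0::complex) 1. Re z < 0 \<and> Im z < 0}"
  have op: "open V" "open N" "open P" "open M"
    unfolding V_def N_def P_def M_def
    by (auto intro!: open_Diff open_Collect_conj open_Collect_less continuous_intros closed_nonpos_Reals_complex
        simp flip: mem_ball Collect_mem_eq simp: Collect_conj_eq)
  have sub: "V \<subseteq> ?B" "N \<subseteq> ?B" "P \<subseteq> N" "M \<subseteq> N"
    by (auto simp: V_def N_def P_def M_def complex_nonpos_Reals_iff)
  have subt: "subtopology ?X S = top_of_set S" if "S \<subseteq> ?B" for S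
    using that by (simp add: subtopology_subtopology Int_absorb1)
  have convP: "convex N" "convex P" "convex M"
  proof -
    have "N = ball 0 1 \<inter> {z. Re z < 0}" "P = ball 0 1 \<inter> {z. Re z < 0} \<inter> {z. Im z > 0}"
      "M = ball 0 1 \<inter> {z. Re z < 0} \<inter> {z. Im z < 0}"
      by (auto simp: N_def P_def M_def)
    then show "convex N" "convex P" "convex M"
      by (auto intro!: convex_Int convex_halfspace_Re_lt convex_halfspace_Im_lt convex_halfspace_Im_gt)
  qed
  have pt: "Complex (-1/2) (1/2) \<in> P" "Complex (-1/2) (-1/2) \<in> M"
    by (auto simp: P_def M_def cmod_def power2_eq_square real_sqrt_lt_1_iff)
  have iso0: "hom_induced p (top_of_set S) {} (top_of_set {0::complex}) {} (\<lambda>_. 0)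
     \<in> iso (homology_group p (top_of_set S)) (homology_group p (top_of_set {0}))"
    if "convex S" "a \<in> S" for S :: "complex set" and a p
    by (rule iso_homology_starlike_fibres [where s = "\<lambda>_. a"])
       (use that in \<open>auto simp: closed_segment_subset\<close>)
  have inc: "hom_induced p (top_of_set S) {} (top_of_set N) {} id
     \<in> iso (homology_group p (top_of_set S)) (homology_group p (top_of_set N))"
    if "convex S" "a \<in> S" "S \<subseteq> N" for S a p
    using iso_homology_inclusion_of_projections [of "top_of_set N" "top_of_set {0}" "\<lambda>_. 0" p S]
      iso0 [of S a p] iso0 [of N a p] convP that
    by (simp add: subtopology_subtopology Int_absorb1 subset_iff)
  have "reduced_homology_group p ?X \<cong> homology_group (p - 1) (subtopology ?X N)"
  proof (rule isomorphic_reduced_homology_two_sided_cover [of ?X V N P M])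
    show "openin ?X V" "openin ?X N" "openin ?X P" "openin ?X M"
      using op sub by (meson open_subset order_trans)+
    show "V \<union> N = topspace ?X"
      by (auto simp: V_def N_def complex_nonpos_Reals_iff complex_eq_iff)
    show "V \<inter> N = P \<union> M"
      by (auto simp: V_def N_def P_def M_def complex_nonpos_Reals_iff)
    show "disjnt P M" by (auto simp: disjnt_def P_def M_def)
    have "1/2 \<in> V" by (auto simp: V_def complex_nonpos_Reals_iff)
    then show "V \<noteq> {}" by auto
    \<comment> \<open>The puncture 0 is missing, so the centre is moved along the positive axis to
      1/2.\<close>
    have "starlike V"
      unfolding starlike_def
    proof (intro bexI [OF _ \<open>1/2 \<in> V\<close>] ballI subsetI)
      fix z w assume z: "z \<in> V" and w: "w \<in> closed_segment (1/2) z"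
      then have "w \<in> ball 0 1"
        using convex_contains_segment [of "ball (0::complex) 1"] \<open>1/2 \<in> V\<close> unfolding V_def by blast
      moreover obtain u where u: "0 \<le> u" "u \<le> 1" "w = (1 - u) *\<^sub>R (1/2) + u *\<^sub>R z"
        using w by (auto simp: in_segment)
      \<comment> \<open>If \<open>u\<close> and \<open>Im z\<close> are both nonzero then
        \<open>w\<close> is not real. If \<open>z\<close> is real it is positive, and so is the
        segment from 1/2 to it.\<close>
      have "w \<notin> \<real>\<^sub>\<le>\<^sub>0"
      proof (cases "Im z = 0 \<or> u = 0")
        case True
        then have "u = 0 \<or> Re z > 0" using z by (auto simp: V_def complex_nonpos_Reals_iff)
        then have "0 < (1 - u) / 2 + u * Re z"
        proof
          assume "Re z > 0"
          then show ?thesis using u by (cases "u = 1") (auto intro: add_pos_nonneg)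
        qed simp
        then show ?thesis using u(3) by (auto simp: complex_nonpos_Reals_iff)
      qed (use u in \<open>auto simp: complex_nonpos_Reals_iff\<close>)
      ultimately show "w \<in> V" by (simp add: V_def)
    qed
    then show "contractible_space (subtopology ?X V)"
      using subt [OF sub(1)] by (simp add: starlike_imp_contractible)
    show "hom_induced p (subtopology ?X P) {} (subtopology ?X N) {} id
        \<in> iso (homology_group p (subtopology ?X P)) (homology_group p (subtopology ?X N))" 
      "hom_induced p (subtopology ?X M) {} (subtopology ?X N) {} id
        \<in> iso (homology_group p (subtopology ?X M)) (homology_group p (subtopology ?X N))" for p
      using inc convP pt sub by (simp_all add: subt)
  qed
  moreover have "homology_group (p - 1) (subtopology ?X N) \<cong> homology_group (p - 1) (top_of_set {0::complex})"
    unfolding subt [OF sub(2)]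
    by (rule is_isoI [OF iso0]) (use convP pt sub in auto)
  ultimately show ?thesis by (rule iso_trans)
qed

section \<open>Local homology at a disc chart\<close>

lemma group_hom_hom_induced:
  "group_hom (relative_homology_group n X S) (relative_homology_group n Y T) (hom_induced n X S Y T f)"
  by (simp add: group_hom_def group_hom_axioms_def hom_induced_hom)

text \<open>The angle is reduced continuously to 0. Every intermediate rotation preserves the norm,
  so this is a homotopy of pairs and applies to the disc relative to its punctured part.\<close>

lemma homotopic_rotation_id_punctured_disc:
  fixes c :: complex
  assumes "norm c = 1"
  shows "homotopic_with (\<lambda>f. f \<in> ball 0 1 - {0} \<rightarrow> ball 0 1 - {0}) (top_of_set (ball 0 1)) (top_of_set (ball 0 1)) (\<lambda>z. c * z) id"
proof -
  obtain t where t: "c = exp (\<i> * complex_of_real t)"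
    using assms by (metis complex_norm_eq_1_exp)
  have "homotopic_with (\<lambda>f. f \<in> ball 0 1 - {0} \<rightarrow> ball 0 1 - {0}) (top_of_set (ball 0 1)) (top_of_set (ball 0 1)) id (\<lambda>z. c * z)"
    unfolding homotopic_with_def
  proof (intro exI conjI ballI allI)
    let ?h = "\<lambda>(s, z). exp (\<i> * complex_of_real (s * t)) * z"
    have "continuous_on ({0..1} \<times> ball 0 1) ?h"
      unfolding case_prod_unfold by (intro continuous_intros)
    moreover have "?h \<in> {0..1} \<times> ball 0 1 \<rightarrow> ball 0 1"
      by (auto simp: norm_mult)
    ultimately show "continuous_map (prod_topology (top_of_set {0..1}) (top_of_set (ball 0 1))) (top_of_set (ball 0 1)) ?h"
      by (simp add: prod_topology_subtopology_eu)
  qed (auto simp: t norm_mult)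
  then show ?thesis by (rule homotopic_with_symD)
qed

text \<open>The chart goes from the disc into the space, so that "\<open>f\<close> is a rotation
  near \<open>p\<close>" reads \<open>f (h z) = h (c * z)\<close>. It is instantiated at the point
  at infinity.\<close>

locale disc_chart =
  fixes X :: "'a topology" and p :: 'a and U :: "'a set" and h :: "complex \<Rightarrow> 'a"
  assumes U: "openin X U" and h: "homeomorphic_map (top_of_set (ball 0 1)) (subtopology X U) h"
    and h0: "h 0 = p" and p_closed: "closedin X {p}"
begin

abbreviation "Y \<equiv> topspace X - {p}"
abbreviation "D \<equiv> top_of_set (ball (0::complex) 1)"

lemma image_chart: "h ` ball 0 1 = U" "h ` (ball 0 1 - {0}) = U - {p}" "p \<in> U"
proof -
  show 1: "h ` ball 0 1 = U"
    using homeomorphic_imp_surjective_map [OF h] openin_subset [OF U] by auto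
  have "inj_on h (ball 0 1)"
    using homeomorphic_imp_injective_map [OF h] by simp
  then have "h ` (ball 0 1 - {0}) = h ` ball 0 1 - h ` {0}"
    by (intro inj_on_image_set_diff) auto
  with 1 h0 show "h ` (ball 0 1 - {0}) = U - {p}" by simp
  show "p \<in> U" using 1 h0 by force
qed

lemma chart_continuous: "continuous_map D X h"
  using homeomorphic_imp_continuous_map [OF h] continuous_map_in_subtopology by blast

lemma chart_punctured: "h \<in> ball 0 1 - {0} \<rightarrow> Y"
  using image_chart(2) openin_subset [OF U] by blast

text \<open>Excising the complement of \<open>U\<close> localises at the point; the chart then
  carries the disc and its puncture to \<open>U\<close> and \<open>p\<close>.\<close>

lemma iso_local_homology:
  "hom_induced n D (ball 0 1 - {0}) X Y h
   \<in> iso (relative_homology_group n D (ball 0 1 - {0})) (relative_homology_group n X Y)"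
proof -
  have 1: "hom_induced n D (ball 0 1 - {0}) (subtopology X U) (U - {p}) h
    \<in> iso (relative_homology_group n D (ball 0 1 - {0})) (relative_homology_group n (subtopology X U) (U - {p}))"
    by (rule homeomorphic_map_relative_homology_iso [OF h]) (use image_chart in auto)
  have "openin X Y" using p_closed by blast
  moreover have "Y \<union> U = topspace X" "Y \<inter> U = U - {p}"
    using openin_subset [OF U] image_chart(3) by auto
  ultimately have 2: "hom_induced n (subtopology X U) (U - {p}) X Y id
    \<in> iso (relative_homology_group n (subtopology X U) (U - {p})) (relative_homology_group n X Y)"
    using iso_hom_induced_excision_cover [of X Y U n] U by simp
  have "hom_induced n (subtopology X U) (U - {p}) X Y id \<circ> hom_induced n D (ball 0 1 - {0}) (subtopology X U) (U - {p}) h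
      = hom_induced n D (ball 0 1 - {0}) X Y (id \<circ> h)"
    by (rule hom_induced_compose [symmetric])
       (use homeomorphic_imp_continuous_map [OF h] image_chart openin_subset [OF U] in \<open>auto simp: continuous_map_id_subt\<close>)
  with iso_set_trans [OF 1 2] show ?thesis by simp
qed

text \<open>The disc is contractible, so relative homology is the reduced homology of the punctured
  disc one degree lower, and slitting the punctured disc lowers the degree once more. The result is
  infinite cyclic in degree 2 and trivial otherwise.\<close>

lemma isomorphic_local_homology:
  "relative_homology_group n X Y \<cong> homology_group (n - 2) (top_of_set {0::complex})"
proof -
  have "relative_homology_group n X Y \<cong> relative_homology_group n D (ball 0 1 - {0})"
    by (rule group.iso_sym [OF _ is_isoI [OF iso_local_homology]]) simp
  also have "\<dots> \<cong> reduced_homology_group (n - 1) (subtopology D (ball 0 1 - {0}))"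
  proof (rule isomorphic_group_relative_homology_of_contractible)
    show "contractible_space D" by (simp add: convex_imp_contractible)
    have "1/2 \<in> topspace D \<inter> (ball (0::complex) 1 - {0})" by simp
    then show "topspace D \<inter> (ball 0 1 - {0}) \<noteq> {}" by blast
  qed
  also have "subtopology D (ball 0 1 - {0}) = top_of_set (ball 0 1 - {0})"
    by (simp add: subtopology_subtopology Int_absorb1)
  also have "reduced_homology_group (n - 1) \<dots> \<cong> homology_group (n - 2) (top_of_set {0::complex})"
    using reduced_homology_punctured_disc [of "n - 1"] by simp
  finally show ?thesis .
qed

lemma hom_induced_rotation_local:
  assumes f: "continuous_map X X f" "f \<in> Y \<rightarrow> Y" and c: "norm c = 1"
    and rot: "\<And>z. z \<in> ball 0 1 \<Longrightarrow> f (h z) = h (c * z)"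
    and x: "x \<in> carrier (relative_homology_group n X Y)"
  shows "hom_induced n X Y X Y f x = x"
proof -
  let ?D = "ball (0::complex) 1 - {0}"
  let ?e = "hom_induced n D ?D X Y h"
  let ?r = "\<lambda>z. c * z"
  have r: "continuous_map D D ?r" "?r \<in> ?D \<rightarrow> ?D"
    using c by (auto simp: norm_mult intro!: continuous_intros)
  have "x \<in> ?e ` carrier (relative_homology_group n D ?D)"
    using iso_local_homology x by (simp add: iso_def bij_betw_def)
  then obtain y where y: "y \<in> carrier (relative_homology_group n D ?D)" and xy: "x = ?e y"
    by (elim imageE)
  have "hom_induced n X Y X Y f x = hom_induced n D ?D X Y (f \<circ> h) y"
    unfolding xy by (rule hom_induced_compose' [OF chart_continuous chart_punctured f])
  also have "\<dots> = hom_induced n D ?D X Y (h \<circ> ?r) y"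
    by (rule fun_cong [OF hom_induced_eq]) (use rot in simp)
  also have "\<dots> = ?e (hom_induced n D ?D D ?D ?r y)"
    by (rule hom_induced_compose' [OF r chart_continuous chart_punctured, symmetric])
  \<comment> \<open>In the chart \<open>f\<close> has become multiplication by \<open>c\<close>,
    which is homotopic to the identity as a map of pairs.\<close>
  also have "hom_induced n D ?D D ?D ?r = hom_induced n D ?D D ?D id"
    by (rule homology_homotopy_axiom [OF homotopic_rotation_id_punctured_disc [OF c]])
  also have "hom_induced n D ?D D ?D id y = y"
    using y by (rule hom_induced_id)
  finally show ?thesis using xy by simp
qed

text \<open>Naturality of the boundary compares two actions of \<open>f\<close>: trivial on the
  local homology, by -1 on the first homology of the complement. Each boundary class therefore
  equals its own negative.\<close>

lemma trivial_boundary: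
  assumes free: "homology_group 1 (subtopology X Y) \<cong> free_Abelian_group S"
    and f: "continuous_map X X f" "f \<in> Y \<rightarrow> Y" and c: "norm c = 1"
    and rot: "\<And>z. z \<in> ball 0 1 \<Longrightarrow> f (h z) = h (c * z)"
    and neg: "\<And>x. x \<in> carrier (homology_group 1 (subtopology X Y)) \<Longrightarrow>
       hom_induced 1 (subtopology X Y) {} (subtopology X Y) {} f x = inv\<^bsub>homology_group 1 (subtopology X Y)\<^esub> x"
    and x: "x \<in> carrier (relative_homology_group 2 X Y)"
  shows "hom_boundary 2 X Y x = \<one>\<^bsub>homology_group 1 (subtopology X Y)\<^esub>"
proof -
  let ?G = "homology_group 1 (subtopology X Y)"
  interpret G: comm_group ?G by simp
  obtain k where k: "k \<in> iso ?G (free_Abelian_group S)"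
    using free by (auto simp: is_iso_def)
  interpret k: group_hom ?G "free_Abelian_group S" k
    by (rule group_hom.intro) (use k in \<open>auto simp: group_hom_axioms_def iso_def\<close>)
  let ?y = "hom_boundary 2 X Y x"
  have y: "?y \<in> carrier ?G"
    using hom_boundary_carrier [of 2 X Y x] by simp
  have "?y = hom_boundary 2 X Y (hom_induced 2 X Y X Y f x)"
    by (simp only: hom_induced_rotation_local [OF f c rot x])
  also have "\<dots> = hom_induced 1 (subtopology X Y) {} (subtopology X Y) {} f ?y"
    using naturality_hom_induced [OF f, of 2] by (simp add: fun_eq_iff)
  also have "\<dots> = inv\<^bsub>?G\<^esub> ?y"
    by (rule neg [OF y])
  finally have "k ?y = k (inv\<^bsub>?G\<^esub> ?y)" by (rule arg_cong)
  then have "k ?y = - k ?y"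
    using k.hom_closed [OF y] y by simp
  \<comment> \<open>The integer coefficients of an element equal to its negative all vanish.\<close>
  then have "k ?y = 0"
    by (intro poly_mapping_eqI) (metis add.inverse_neutral equal_neg_zero lookup_uminus lookup_zero)
  moreover have "inj_on k (carrier ?G)" using k by (simp add: iso_def bij_betw_def)
  ultimately show ?thesis
    using y k.hom_one by (metis G.one_closed inj_onD one_free_Abelian_group)
qed

text \<open>A zero boundary map breaks the long exact sequence of the pair: \<open>H\<^sub>2\<close>
  of the space becomes the local homology, as \<open>H\<^sub>2\<close> of the complement is trivial,
  and \<open>H\<^sub>1\<close> of the complement becomes that of the space. Filling in the point
  thus adds the fundamental class and leaves \<open>H\<^sub>1\<close> unchanged.\<close>

lemma surface_homology:
  assumes H2: "trivial_group (homology_group 2 (subtopology X Y))"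
    and free: "homology_group 1 (subtopology X Y) \<cong> free_Abelian_group S"
    and f: "continuous_map X X f" "f \<in> Y \<rightarrow> Y" and c: "norm c = 1"
    and rot: "\<And>z. z \<in> ball 0 1 \<Longrightarrow> f (h z) = h (c * z)"
    and neg: "\<And>x. x \<in> carrier (homology_group 1 (subtopology X Y)) \<Longrightarrow>
       hom_induced 1 (subtopology X Y) {} (subtopology X Y) {} f x = inv\<^bsub>homology_group 1 (subtopology X Y)\<^esub> x"
  shows "hom_induced 2 X {} X Y id \<in> iso (homology_group 2 X) (relative_homology_group 2 X Y)"
    and "homology_group 2 X \<cong> integer_group"
    and "homology_group 1 X \<cong> free_Abelian_group S"
proof -
  let ?Y = "subtopology X Y"
  have bd: "hom_boundary 2 X Y x = \<one>\<^bsub>homology_group 1 ?Y\<^esub>" if "x \<in> carrier (relative_homology_group 2 X Y)" for x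
    using trivial_boundary [OF free f c rot neg that] by simp
  have ex1: "exact_seq ([homology_group 1 ?Y, relative_homology_group 2 X Y, homology_group 2 X, homology_group 2 ?Y],
     [hom_boundary 2 X Y, hom_induced 2 X {} X Y id, hom_induced 2 ?Y {} X {} id])"
    using homology_exactness_axiom_1 [of 2 X Y] homology_exactness_axiom_3 [of 2 X Y] by simp
  have ex2: "exact_seq ([relative_homology_group 1 X Y, homology_group 1 X, homology_group 1 ?Y, relative_homology_group 2 X Y],
     [hom_induced 1 X {} X Y id, hom_induced 1 ?Y {} X {} id, hom_boundary 2 X Y])"
    using homology_exactness_axiom_2 [of 2 X Y] homology_exactness_axiom_3 [of 1 X Y] by simp
  show iso2: "hom_induced 2 X {} X Y id \<in> iso (homology_group 2 X) (relative_homology_group 2 X Y)"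
  proof -
    have "inj_on (hom_induced 2 X {} X Y id) (carrier (homology_group 2 X))"
    proof -
      interpret j: group_hom "homology_group 2 X" "relative_homology_group 2 X Y" "hom_induced 2 X {} X Y id"
        by (rule group_hom_hom_induced)
      interpret i: group_hom "homology_group 2 ?Y" "homology_group 2 X" "hom_induced 2 ?Y {} X {} id"
        by (rule group_hom_hom_induced)
      have "kernel (homology_group 2 X) (relative_homology_group 2 X Y) (hom_induced 2 X {} X Y id)
          = hom_induced 2 ?Y {} X {} id ` carrier (homology_group 2 ?Y)"
        using ex1 by simp
      also have "\<dots> = hom_induced 2 ?Y {} X {} id ` {\<one>\<^bsub>homology_group 2 ?Y\<^esub>}"
        using H2 unfolding trivial_group_def by (simp only:)
      also have "\<dots> = {\<one>\<^bsub>homology_group 2 X\<^esub>}"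
        by (simp only: image_insert image_empty i.hom_one)
      finally show ?thesis
        by (simp only: j.inj_iff_trivial_ker)
    qed
    moreover have "hom_induced 2 X {} X Y id ` carrier (homology_group 2 X) = carrier (relative_homology_group 2 X Y)"
    proof -
      have "hom_induced 2 X {} X Y id ` carrier (homology_group 2 X)
          = kernel (relative_homology_group 2 X Y) (homology_group 1 ?Y) (hom_boundary 2 X Y)"
        using ex1 by simp
      also have "\<dots> = carrier (relative_homology_group 2 X Y)"
        unfolding kernel_def using bd by blast
      finally show ?thesis .
    qed
    ultimately show ?thesis
      by (simp add: iso_def bij_betw_def hom_induced_hom)
  qed
  have "relative_homology_group 2 X Y \<cong> integer_group"
  proof -
    have "homology_group 0 (top_of_set {0::complex}) \<cong> integer_group"
      by (rule homology_coefficients) simp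
    then show ?thesis
      using iso_trans [OF isomorphic_local_homology [of 2]] by simp
  qed
  then show "homology_group 2 X \<cong> integer_group"
    using iso_trans [OF is_isoI [OF iso2]] by blast
  \<comment> \<open>This is the homology of a point in degree -1.\<close>
  have triv1: "trivial_group (relative_homology_group 1 X Y)"
    using isomorphic_local_homology [of 1] isomorphic_group_triviality
    by (metis diff_less_0_iff_less group_relative_homology_group one_less_numeral_iff semiring_norm(76) trivial_homology_group)
  have "hom_induced 1 ?Y {} X {} id \<in> iso (homology_group 1 ?Y) (homology_group 1 X)"
  proof -
    have "inj_on (hom_induced 1 ?Y {} X {} id) (carrier (homology_group 1 ?Y))"
    proof -
      interpret i: group_hom "homology_group 1 ?Y" "homology_group 1 X" "hom_induced 1 ?Y {} X {} id"
        by (rule group_hom_hom_induced)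
      have "kernel (homology_group 1 ?Y) (homology_group 1 X) (hom_induced 1 ?Y {} X {} id)
          = hom_boundary 2 X Y ` carrier (relative_homology_group 2 X Y)"
        using ex2 by simp
      also have "\<dots> = (\<lambda>x. \<one>\<^bsub>homology_group 1 ?Y\<^esub>) ` carrier (relative_homology_group 2 X Y)"
        using bd by (rule image_cong [OF refl])
      also have "\<dots> = {\<one>\<^bsub>homology_group 1 ?Y\<^esub>}"
        using group.is_monoid [OF group_relative_homology_group [of 2 X Y]] monoid.one_closed by blast
      finally show ?thesis
        by (simp only: i.inj_iff_trivial_ker)
    qed
    moreover have "hom_induced 1 ?Y {} X {} id ` carrier (homology_group 1 ?Y) = carrier (homology_group 1 X)"
    proof -
      have "hom_induced 1 ?Y {} X {} id ` carrier (homology_group 1 ?Y)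
          = kernel (homology_group 1 X) (relative_homology_group 1 X Y) (hom_induced 1 X {} X Y id)"
        using ex2 by simp
      also have "\<dots> = carrier (homology_group 1 X)"
        unfolding kernel_def using triv1 hom_induced_carrier [of 1 X "{}" X Y id]
        unfolding trivial_group_def by blast
      finally show ?thesis .
    qed
    ultimately show ?thesis
      by (simp add: iso_def bij_betw_def hom_induced_hom)
  qed
  then have "homology_group 1 X \<cong> homology_group 1 ?Y"
    by (rule group.iso_sym [OF _ is_isoI, rotated]) simp
  then show "homology_group 1 X \<cong> free_Abelian_group S"
    using free by (rule iso_trans)
qed

lemma hom_induced_rotation_trivial:
  assumes inj: "inj_on (hom_induced n X {} X Y id) (carrier (homology_group n X))"
    and f: "continuous_map X X f" "f \<in> Y \<rightarrow> Y" and c: "norm c = 1"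
    and rot: "\<And>z. z \<in> ball 0 1 \<Longrightarrow> f (h z) = h (c * z)"
    and x: "x \<in> carrier (homology_group n X)"
  shows "hom_induced n X {} X {} f x = x"
proof -
  let ?j = "hom_induced n X {} X Y id"
  have "?j (hom_induced n X {} X {} f x) = hom_induced n X Y X Y f (?j x)"
    using f by (simp add: hom_induced_compose')
  also have "\<dots> = ?j x"
    by (rule hom_induced_rotation_local [OF f c rot hom_induced_carrier])
  finally show ?thesis
    using inj x by (simp add: inj_on_def hom_induced_carrier)
qed

end

section \<open>Homology of the affine curve\<close>

lemma continuous_on_csqrt':
  assumes "continuous_on S f" "\<And>z. z \<in> S \<Longrightarrow> f z \<notin> \<real>\<^sub>\<le>\<^sub>0"
  shows "continuous_on S (\<lambda>z. csqrt (f z))"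
  by (rule continuous_on_compose2 [OF continuous_on_csqrt assms(1)]) (use assms in auto)

text \<open>This describes \<open>slit_plane\<close>: the plane without the two vertical rays
  leading outwards from \<i> and from its negative.\<close>

lemma one_plus_square_nonpos_Reals_iff:
  "1 + w\<^sup>2 \<in> \<real>\<^sub>\<le>\<^sub>0 \<longleftrightarrow> Re w = 0 \<and> 1 \<le> \<bar>Im w\<bar>"
proof -
  have "1 + w\<^sup>2 \<in> \<real>\<^sub>\<le>\<^sub>0 \<longleftrightarrow> 1 + (Re w)\<^sup>2 \<le> (Im w)\<^sup>2 \<and> (Re w = 0 \<or> Im w = 0)"
    by (simp add: complex_nonpos_Reals_iff Re_power2 Im_power2) (auto simp: algebra_simps)
  also have "\<dots> \<longleftrightarrow> Re w = 0 \<and> 1 \<le> (Im w)\<^sup>2"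
    by (auto simp: add_nonneg_eq_0_iff dest: order_trans [OF add_increasing2 [OF zero_le_power2 order_refl]])
  also have "1 \<le> (Im w)\<^sup>2 \<longleftrightarrow> 1 \<le> \<bar>Im w\<bar>"
    by (metis abs_le_square_iff abs_one one_power2)
  finally show ?thesis .
qed

lemma minus_square_nonpos_Reals_iff: "- (w\<^sup>2) \<in> \<real>\<^sub>\<le>\<^sub>0 \<longleftrightarrow> Im w = 0"
proof -
  have "- (w\<^sup>2) \<in> \<real>\<^sub>\<le>\<^sub>0 \<longleftrightarrow> (Im w)\<^sup>2 \<le> (Re w)\<^sup>2 \<and> (Re w = 0 \<or> Im w = 0)"
    by (simp add: complex_nonpos_Reals_iff Re_power2 Im_power2)
  then show ?thesis by auto
qed

section \<open>The affine curve, its star part and its bands\<close>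

definition hyperelliptic_curve :: "nat \<Rightarrow> (complex \<times> complex) set" where
  "hyperelliptic_curve g = {q. (snd q)\<^sup>2 = fst q * (fst q ^ (2*g) - 1)}"

locale hyperelliptic =
  fixes g :: nat
  assumes g: "g > 0"
begin

abbreviation "curve \<equiv> hyperelliptic_curve g"

text \<open>\<open>star_part\<close> removes the points over the 2g rays on which x^(2g) is real and
  at least 1. \<open>band_part\<close> lies over the open sectors centred on the rays where x^(2g)
  is positive; the boundaries of the sectors, where x^(2g) is real and at most 0, are left
  out.\<close>

definition "star_part = {q \<in> curve. 1 - fst q ^ (2*g) \<notin> \<real>\<^sub>\<le>\<^sub>0}"
definition "band_part = {q \<in> curve. fst q ^ (2*g) \<notin> \<real>\<^sub>\<le>\<^sub>0}"

text \<open>On the band around a root of unity \<open>u\<close> we have \<open>x = u (x\<^bsup>2g\<^esup>)\<^bsup>1/2g\<^esup>\<close> with the principal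
  branch, and \<open>w = y / \<surd>x\<close> is a coordinate satisfying \<open>1 + w\<^sup>2 = x\<^bsup>2g\<^esup>\<close>; the cut is \<open>Im w = 0\<close>.\<close>

definition "proot x = exp (Ln x / of_nat (4*g))"
definition "band q = fst q / (proot (fst q ^ (2*g)))\<^sup>2"
text \<open>The denominator is a square root of x that is continuous on every band, since
  \<open>band q\<close> takes finitely many values and the other factor is a principal root. The
  plain \<open>csqrt x\<close> would jump on the band around -1. A 4g-th root is used because both x
  and its square root have to be expressed through it.\<close>

definition "band_coord q = (band q, snd q / (csqrt (band q) * proot (fst q ^ (2*g))))"
definition "band_point = (\<lambda>(u, w). (u * (proot (1 + w\<^sup>2))\<^sup>2, csqrt u * proot (1 + w\<^sup>2) * w))"
definition "unity_roots = {u::complex. u ^ (2*g) = 1}"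
definition "slit_plane = {w::complex. 1 + w\<^sup>2 \<notin> \<real>\<^sub>\<le>\<^sub>0}"
definition "upper_band = {q \<in> band_part. Im (snd (band_coord q)) > 0}"
definition "lower_band = {q \<in> band_part. Im (snd (band_coord q)) < 0}"

lemma curve_iff: "(x, y) \<in> curve \<longleftrightarrow> y\<^sup>2 = x * (x ^ (2*g) - 1)"
  by (simp add: hyperelliptic_curve_def)

lemma proot_power: "x \<noteq> 0 \<Longrightarrow> proot x ^ (4*g) = x"
  unfolding proot_def using g by (subst exp_of_nat_mult [symmetric]) auto

lemma proot_nonzero [simp]: "proot x \<noteq> 0"
  by (simp add: proot_def)

lemma continuous_on_proot:
  assumes "continuous_on S f" "\<And>z. z \<in> S \<Longrightarrow> f z \<notin> \<real>\<^sub>\<le>\<^sub>0"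
  shows "continuous_on S (\<lambda>z. proot (f z))"
  unfolding proot_def by (intro continuous_intros assms) (use g assms in auto)

lemma finite_unity_roots: "finite unity_roots" and card_unity_roots: "card unity_roots = 2*g"
  using g by (auto simp: unity_roots_def card_roots_unity_eq intro: finite_roots_unity)

text \<open>Off the cuts 1 - x^(2g) has a continuous principal square root, and dividing it out of y
  leaves a coordinate z with \<open>z\<^sup>2 = x\<close>. In this coordinate the star part is the
  plane without the rays where z^(4g) is at least 1, a set star-shaped about 0.\<close>

lemma contractible_star_part: "contractible_space (top_of_set star_part)"
proof -
  define Z where "Z = {z::complex. 1 - z ^ (4*g) \<notin> \<real>\<^sub>\<le>\<^sub>0}"
  \<comment> \<open>The equation reads \<open>y\<^sup>2 = - z\<^sup>2 (1 - z^(4g))\<close> for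
    \<open>x = z\<^sup>2\<close>; the factor \<i> accounts for the sign.\<close>
  let ?a = "\<lambda>z. (z\<^sup>2, \<i> * z * csqrt (1 - z ^ (4*g)))"
  let ?b = "\<lambda>q. snd q / (\<i> * csqrt (1 - fst q ^ (2*g)))"
  have pow: "(z\<^sup>2) ^ (2*g) = z ^ (4*g)" for z :: complex
    by (simp flip: power_mult)
  have a: "?a z \<in> star_part" if "z \<in> Z" for z
    using that by (simp add: star_part_def Z_def curve_iff pow power_mult_distrib) (simp add: algebra_simps)
  have nz: "csqrt (1 - fst q ^ (2*g)) \<noteq> 0" if "q \<in> star_part" for q
    using that by (auto simp: star_part_def)
  have b2: "(?b q)\<^sup>2 = fst q" if "q \<in> star_part" for q
  proof -
    have "1 - fst q ^ (2*g) \<noteq> 0" using nz [OF that] by auto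
    moreover have "(snd q)\<^sup>2 = fst q * (fst q ^ (2*g) - 1)"
      using that by (simp add: star_part_def hyperelliptic_curve_def)
    ultimately show ?thesis
      by (simp add: power_divide power_mult_distrib field_simps)
  qed
  have b: "?b q \<in> Z" and ab: "?a (?b q) = q" if "q \<in> star_part" for q
  proof -
    have *: "(?b q) ^ (4*g) = fst q ^ (2*g)"
      using b2 [OF that] pow by metis
    show "?b q \<in> Z"
      unfolding Z_def mem_Collect_eq * using that by (simp add: star_part_def)
    show "?a (?b q) = q"
      unfolding * b2 [OF that] using nz [OF that] by (simp add: prod_eq_iff)
  qed
  have ba: "?b (?a z) = z" if "z \<in> Z" for z
    using nz [OF a [OF that]] by (simp add: pow)
  have "homeomorphic_maps (top_of_set Z) (top_of_set star_part) ?a ?b"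
    unfolding homeomorphic_maps_def
  proof (intro conjI ballI)
    have "continuous_on Z ?a"
      by (intro continuous_intros continuous_on_csqrt') (auto simp: Z_def)
    then show "continuous_map (top_of_set Z) (top_of_set star_part) ?a"
      using a by auto
    have "continuous_on star_part ?b"
      by (intro continuous_intros continuous_on_csqrt') (use nz in \<open>auto simp: star_part_def\<close>)
    then show "continuous_map (top_of_set star_part) (top_of_set Z) ?b"
      using b by auto
  qed (use ab ba in auto)
  then have hom: "top_of_set Z homeomorphic_space top_of_set star_part"
    by (rule homeomorphic_maps_imp_homeomorphic_space)
  have "0 \<in> Z" using g by (simp add: Z_def zero_power complex_nonpos_Reals_iff)
  have "starlike Z"
    unfolding starlike_def
  proof (intro bexI [OF _ \<open>0 \<in> Z\<close>] ballI subsetI)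
    fix z w assume z: "z \<in> Z" and "w \<in> closed_segment 0 z"
    then obtain t where t: "0 \<le> t" "t \<le> 1" "w = t *\<^sub>R z"
      by (auto simp: in_segment)
    show "w \<in> Z"
    proof (rule ccontr)
      assume "w \<notin> Z"
      \<comment> \<open>Were a point t z on a removed ray, z^(4g) would be real and at least
        t^(-4g), hence at least 1, so z itself would have been removed.\<close>
      then have "1 - of_real (t ^ (4*g)) * z ^ (4*g) \<in> \<real>\<^sub>\<le>\<^sub>0"
        by (simp add: Z_def t scaleR_conv_of_real power_mult_distrib)
      then have re: "1 \<le> t ^ (4*g) * Re (z ^ (4*g))" and im: "t ^ (4*g) * Im (z ^ (4*g)) = 0"
        by (simp_all add: complex_nonpos_Reals_iff)
      have t1: "t ^ (4*g) \<le> 1" "0 \<le> t ^ (4*g)" using t by (auto intro: power_le_one)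
      have "t ^ (4*g) \<noteq> 0"
      proof
        assume "t ^ (4*g) = 0"
        with re show False by (simp only: mult_zero_left)
      qed
      then have "Im (z ^ (4*g)) = 0" using im by (metis mult_eq_0_iff)
      moreover have "1 \<le> Re (z ^ (4*g))"
        using re t1 by (smt (verit) mult_left_le_one_le mult_nonneg_nonpos)
      ultimately have "1 - z ^ (4*g) \<in> \<real>\<^sub>\<le>\<^sub>0"
        by (simp add: complex_nonpos_Reals_iff)
      with z show False by (simp add: Z_def)
    qed
  qed
  then have "contractible_space (top_of_set Z)"
    by (simp add: starlike_imp_contractible)
  with hom show ?thesis
    using homeomorphic_space_contractibility by blast
qed

lemma band_in_unity_roots: "q \<in> band_part \<Longrightarrow> band q \<in> unity_roots"
proof -
  assume "q \<in> band_part"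
  then have "fst q ^ (2*g) \<notin> \<real>\<^sub>\<le>\<^sub>0" by (simp add: band_part_def)
  then have nz: "fst q ^ (2*g) \<noteq> 0" by (metis nonpos_Reals_zero_I)
  have "((proot (fst q ^ (2*g)))\<^sup>2) ^ (2*g) = fst q ^ (2*g)"
    using proot_power [OF nz] by (simp flip: power_mult)
  with nz show ?thesis by (simp add: unity_roots_def band_def power_divide)
qed

lemma band_point_power:
  assumes "u \<in> unity_roots" "w \<in> slit_plane"
  shows "fst (band_point (u, w)) ^ (2*g) = 1 + w\<^sup>2"
proof -
  have "1 + w\<^sup>2 \<noteq> 0" using assms by (auto simp: slit_plane_def)
  then have "((proot (1 + w\<^sup>2))\<^sup>2) ^ (2*g) = 1 + w\<^sup>2"
    using proot_power by (simp flip: power_mult)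
  with assms show ?thesis by (simp add: band_point_def unity_roots_def power_mult_distrib)
qed

lemma band_point_in_band_part:
  assumes "u \<in> unity_roots" "w \<in> slit_plane"
  shows "band_point (u, w) \<in> band_part"
  using band_point_power [OF assms] assms(2)
  by (simp add: band_part_def hyperelliptic_curve_def slit_plane_def)
     (simp add: band_point_def power_mult_distrib)

lemma band_coord_band_point:
  assumes "u \<in> unity_roots" "w \<in> slit_plane"
  shows "band_coord (band_point (u, w)) = (u, w)"
proof -
  have "u \<noteq> 0" using assms g by (auto simp: unity_roots_def power_0_left)
  have "band (band_point (u, w)) = u"
    unfolding band_def band_point_power [OF assms] by (simp add: band_point_def)
  then show ?thesis
    unfolding band_coord_def band_point_power [OF assms] using \<open>u \<noteq> 0\<close> by (simp add: band_point_def)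
qed

text \<open>The denominator of w squares to x, so \<open>w\<^sup>2 = y\<^sup>2 / x\<close>, which
  the equation of the curve turns into x^(2g) - 1.\<close>

lemma band_coord_snd_square:
  assumes "q \<in> band_part"
  shows "1 + (snd (band_coord q))\<^sup>2 = fst q ^ (2*g)"
proof -
  have nz: "fst q \<noteq> 0" using assms g by (auto simp: band_part_def zero_power)
  have "(csqrt (band q) * proot (fst q ^ (2*g)))\<^sup>2 = fst q"
    by (simp add: power_mult_distrib) (simp add: band_def)
  then have "(snd (band_coord q))\<^sup>2 = (snd q)\<^sup>2 / fst q"
    by (simp add: band_coord_def power_divide)
  also have "\<dots> = fst q ^ (2*g) - 1"
    using assms nz by (simp add: band_part_def hyperelliptic_curve_def)
  finally show ?thesis by simp
qed

lemma band_coord_in: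
  assumes "q \<in> band_part"
  shows "band_coord q \<in> unity_roots \<times> slit_plane"
  using band_in_unity_roots [OF assms] band_coord_snd_square [OF assms] assms
  by (simp add: mem_Times_iff slit_plane_def band_part_def) (simp add: band_coord_def)

lemma band_point_band_coord:
  assumes "q \<in> band_part"
  shows "band_point (band_coord q) = q"
proof -
  have nz: "band q \<noteq> 0" using band_in_unity_roots [OF assms] g by (auto simp: unity_roots_def power_0_left)
  have "band_point (band_coord q) = (band q * (proot (fst q ^ (2*g)))\<^sup>2, csqrt (band q) * proot (fst q ^ (2*g)) * snd (band_coord q))"
    unfolding band_coord_snd_square [OF assms, symmetric]
    by (simp add: band_point_def case_prod_unfold) (simp add: band_coord_def)
  also have "\<dots> = q"
    using nz by (simp add: band_coord_def prod_eq_iff) (simp add: band_def)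
  finally show ?thesis .
qed

lemma continuous_on_band: "continuous_on band_part band"
  unfolding band_def
  by (intro continuous_intros continuous_on_proot) (auto simp: band_part_def)

text \<open>One root of unity, -1, lies on the branch cut of \<open>csqrt\<close>; continuity comes
  from the finiteness of the set of values.\<close>

lemma continuous_on_csqrt_unity_roots:
  assumes "continuous_on S f" "f \<in> S \<rightarrow> unity_roots"
  shows "continuous_on S (\<lambda>x. csqrt (f x))"
  by (rule continuous_on_compose2 [OF continuous_on_finite [OF finite_unity_roots] assms(1)]) (use assms in auto)

lemma continuous_on_band_coord: "continuous_on band_part band_coord"
proof -
  have "band q \<noteq> 0" if "q \<in> band_part" for q
    using band_in_unity_roots [OF that] g by (auto simp: unity_roots_def power_0_left)
  then show ?thesis
    unfolding band_coord_def
    by (intro continuous_intros continuous_on_proot continuous_on_band continuous_on_csqrt_unity_roots)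
       (auto simp: band_in_unity_roots, auto simp: band_part_def)
qed

lemma continuous_on_band_point: "continuous_on (unity_roots \<times> slit_plane) band_point"
  unfolding band_point_def case_prod_unfold
  by (intro continuous_intros continuous_on_proot continuous_on_csqrt_unity_roots)
     (auto simp: slit_plane_def)

text \<open>Stated for any part \<open>T\<close> of the slit plane, so that whole bands, upper sides
  and lower sides are treated at once.\<close>

lemma homeomorphic_maps_band_coord:
  assumes T: "T \<subseteq> slit_plane"
  shows "homeomorphic_maps (top_of_set {q \<in> band_part. snd (band_coord q) \<in> T}) (top_of_set (unity_roots \<times> T)) band_coord band_point"
  unfolding homeomorphic_maps_def
proof (intro conjI ballI)
  have "continuous_on {q \<in> band_part. snd (band_coord q) \<in> T} band_coord"
    by (rule continuous_on_subset [OF continuous_on_band_coord]) auto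
  then show "continuous_map (top_of_set {q \<in> band_part. snd (band_coord q) \<in> T}) (top_of_set (unity_roots \<times> T)) band_coord"
    using band_coord_in by (fastforce simp: mem_Times_iff)
  have "continuous_on (unity_roots \<times> T) band_point"
    by (rule continuous_on_subset [OF continuous_on_band_point]) (use T in auto)
  then show "continuous_map (top_of_set (unity_roots \<times> T)) (top_of_set {q \<in> band_part. snd (band_coord q) \<in> T}) band_point"
    using T by (auto simp: band_point_in_band_part band_coord_band_point subset_iff)
qed (use T in \<open>auto simp: band_point_band_coord band_coord_band_point subset_iff\<close>)

text \<open>In band coordinates the set is a product of the roots of unity with \<open>T\<close>,
  and \<open>T\<close> shrinks to its centre \<open>a\<close> along segments.\<close>

lemma iso_homology_band:
  assumes T: "T \<subseteq> slit_plane" "a \<in> T" and star: "\<And>w. w \<in> T \<Longrightarrow> closed_segment a w \<subseteq> T"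
  shows "hom_induced p (top_of_set {q \<in> band_part. snd (band_coord q) \<in> T}) {} (top_of_set unity_roots) {} band
     \<in> iso (homology_group p (top_of_set {q \<in> band_part. snd (band_coord q) \<in> T})) (homology_group p (top_of_set unity_roots))"
proof -
  let ?A = "top_of_set {q \<in> band_part. snd (band_coord q) \<in> T}"
  let ?B = "top_of_set (unity_roots \<times> T)"
  let ?R = "top_of_set unity_roots"
  have hm: "homeomorphic_map ?A ?B band_coord"
    using homeomorphic_maps_band_coord [OF T(1)] by (rule homeomorphic_maps_imp_map)
  have 1: "hom_induced p ?A {} ?B {} band_coord \<in> iso (homology_group p ?A) (homology_group p ?B)"
    by (rule homeomorphic_map_homology_iso [OF hm])
  have 2: "hom_induced p ?B {} ?R {} fst \<in> iso (homology_group p ?B) (homology_group p ?R)"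
  proof (rule iso_homology_starlike_fibres [where s = "\<lambda>u. (u, a)"])
    show "closed_segment (fst q, a) q \<subseteq> unity_roots \<times> T" if q: "q \<in> unity_roots \<times> T" for q
    proof
      fix r assume "r \<in> closed_segment (fst q, a) q"
      then obtain t where t: "0 \<le> t" "t \<le> 1" "r = (1 - t) *\<^sub>R (fst q, a) + t *\<^sub>R q"
        by (auto simp: in_segment)
      then have "fst r = fst q" "snd r = (1 - t) *\<^sub>R a + t *\<^sub>R snd q"
        by (simp_all add: algebra_simps)
      then have "fst r = fst q" "snd r \<in> closed_segment a (snd q)"
        using t by (auto simp: in_segment)
      then show "r \<in> unity_roots \<times> T"
        using q star by (auto simp: mem_Times_iff)
    qed
  qed (use T in \<open>auto intro!: continuous_intros\<close>)
  have "hom_induced p ?B {} ?R {} fst \<circ> hom_induced p ?A {} ?B {} band_coord = hom_induced p ?A {} ?R {} (fst \<circ> band_coord)"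
    by (rule hom_induced_compose_empty [symmetric])
       (use homeomorphic_imp_continuous_map [OF hm] in \<open>auto intro!: continuous_intros\<close>)
  also have "fst \<circ> band_coord = band" by (auto simp: band_coord_def)
  finally have eq: "hom_induced p ?B {} ?R {} fst \<circ> hom_induced p ?A {} ?B {} band_coord = hom_induced p ?A {} ?R {} band" .
  show ?thesis
    using iso_set_trans [OF 1 2] unfolding eq .
qed

lemma starlike_slit_planes:
  "0 \<in> slit_plane" "w \<in> slit_plane \<Longrightarrow> closed_segment 0 w \<subseteq> slit_plane"
  "\<i>/2 \<in> {w \<in> slit_plane. Im w > 0}"
  "w \<in> {w \<in> slit_plane. Im w > 0} \<Longrightarrow> closed_segment (\<i>/2) w \<subseteq> {w \<in> slit_plane. Im w > 0}"
  "-\<i>/2 \<in> {w \<in> slit_plane. Im w < 0}"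
  "w \<in> {w \<in> slit_plane. Im w < 0} \<Longrightarrow> closed_segment (-\<i>/2) w \<subseteq> {w \<in> slit_plane. Im w < 0}"
proof -
  have slit: "w \<in> slit_plane \<longleftrightarrow> Re w \<noteq> 0 \<or> \<bar>Im w\<bar> < 1" for w
    by (auto simp: slit_plane_def one_plus_square_nonpos_Reals_iff)
  have conv: "convex {w::complex. \<bar>Im w\<bar> < 1}"
  proof -
    have "{w::complex. \<bar>Im w\<bar> < 1} = {w. Im w < 1} \<inter> {w. Im w > -1}" by auto
    then show ?thesis by (simp add: convex_Int convex_halfspace_Im_lt convex_halfspace_Im_gt)
  qed
  \<comment> \<open>Any point strictly between the tips of the two slits serves as a centre: a
    segment to a point off the imaginary axis leaves the axis at once, and a segment to a point on
    it stays between the tips. The centres with imaginary part 1/2 and -1/2 also lie in the required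
    half-planes.\<close>
  have seg: "closed_segment a w \<subseteq> slit_plane" if "Re a = 0" "\<bar>Im a\<bar> < 1" "w \<in> slit_plane" for a w
  proof
    fix z assume z: "z \<in> closed_segment a w"
    then obtain t where t: "0 \<le> t" "t \<le> 1" "z = (1 - t) *\<^sub>R a + t *\<^sub>R w"
      by (auto simp: in_segment)
    show "z \<in> slit_plane"
    proof (cases "Re w = 0")
      case True
      then have "closed_segment a w \<subseteq> {w. \<bar>Im w\<bar> < 1}"
        using that conv by (intro closed_segment_subset) (auto simp: slit)
      with z show ?thesis by (auto simp: slit)
    next
      case False
      then show ?thesis using t that by (cases "t = 0") (auto simp: slit)
    qed
  qed
  have up: "closed_segment a w \<subseteq> {w. Im w > 0}" if "Im a > 0" "Im w > 0" for a w
    by (rule closed_segment_subset) (use that in \<open>auto simp: convex_halfspace_Im_gt\<close>)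
  have lo: "closed_segment a w \<subseteq> {w. Im w < 0}" if "Im a < 0" "Im w < 0" for a w
    by (rule closed_segment_subset) (use that in \<open>auto simp: convex_halfspace_Im_lt\<close>)
  show "0 \<in> slit_plane" "\<i>/2 \<in> {w \<in> slit_plane. Im w > 0}" "-\<i>/2 \<in> {w \<in> slit_plane. Im w < 0}"
    by (simp_all add: slit)
  show "w \<in> slit_plane \<Longrightarrow> closed_segment 0 w \<subseteq> slit_plane"
    using seg [of 0 w] by simp
  show "w \<in> {w \<in> slit_plane. Im w > 0} \<Longrightarrow> closed_segment (\<i>/2) w \<subseteq> {w \<in> slit_plane. Im w > 0}"
    using seg [of "\<i>/2" w] up [of "\<i>/2" w] by auto
  show "w \<in> {w \<in> slit_plane. Im w < 0} \<Longrightarrow> closed_segment (-\<i>/2) w \<subseteq> {w \<in> slit_plane. Im w < 0}"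
    using seg [of "-\<i>/2" w] lo [of "-\<i>/2" w] by auto
qed

lemma iso_homology_band_parts:
  "hom_induced p (top_of_set band_part) {} (top_of_set unity_roots) {} band
     \<in> iso (homology_group p (top_of_set band_part)) (homology_group p (top_of_set unity_roots))"
  "hom_induced p (top_of_set upper_band) {} (top_of_set unity_roots) {} band
     \<in> iso (homology_group p (top_of_set upper_band)) (homology_group p (top_of_set unity_roots))"
  "hom_induced p (top_of_set lower_band) {} (top_of_set unity_roots) {} band
     \<in> iso (homology_group p (top_of_set lower_band)) (homology_group p (top_of_set unity_roots))"
proof -
  have slit: "q \<in> band_part \<Longrightarrow> snd (band_coord q) \<in> slit_plane" for q
    using band_coord_in [of q] by (auto simp: mem_Times_iff)
  have "{q \<in> band_part. snd (band_coord q) \<in> slit_plane} = band_part"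
    "{q \<in> band_part. snd (band_coord q) \<in> {w \<in> slit_plane. Im w > 0}} = upper_band"
    "{q \<in> band_part. snd (band_coord q) \<in> {w \<in> slit_plane. Im w < 0}} = lower_band"
    using slit by (auto simp: upper_band_def lower_band_def)
  then show
  "hom_induced p (top_of_set band_part) {} (top_of_set unity_roots) {} band
     \<in> iso (homology_group p (top_of_set band_part)) (homology_group p (top_of_set unity_roots))"
  "hom_induced p (top_of_set upper_band) {} (top_of_set unity_roots) {} band
     \<in> iso (homology_group p (top_of_set upper_band)) (homology_group p (top_of_set unity_roots))"
  "hom_induced p (top_of_set lower_band) {} (top_of_set unity_roots) {} band
     \<in> iso (homology_group p (top_of_set lower_band)) (homology_group p (top_of_set unity_roots))"
    using iso_homology_band [OF _ starlike_slit_planes(1,2), of p]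
      iso_homology_band [OF _ starlike_slit_planes(3,4), of p]
      iso_homology_band [OF _ starlike_slit_planes(5,6), of p] by auto
qed

section \<open>The two-sided cover of the curve and the sheet swap\<close>

abbreviation "sheet_swap \<equiv> (\<lambda>q::complex \<times> complex. (fst q, - snd q))"

lemma sheet_swap_band_coord:
  "band_coord (sheet_swap q) = (band q, - snd (band_coord q))" "band (sheet_swap q) = band q"
  by (simp_all add: band_coord_def band_def)

lemma two_sided_cover_curve:
  defines "X \<equiv> top_of_set curve"
  shows "openin X star_part" "openin X band_part" "star_part \<union> band_part = topspace X"
    "contractible_space (subtopology X star_part)" "star_part \<noteq> {}"
    "star_part \<inter> band_part = upper_band \<union> lower_band"
    "openin X upper_band" "openin X lower_band" "disjnt upper_band lower_band"
    "subtopology X band_part = top_of_set band_part"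
    "hom_induced p (subtopology X upper_band) {} (subtopology X band_part) {} id
        \<in> iso (homology_group p (subtopology X upper_band)) (homology_group p (subtopology X band_part))"
    "hom_induced p (subtopology X lower_band) {} (subtopology X band_part) {} id
        \<in> iso (homology_group p (subtopology X lower_band)) (homology_group p (subtopology X band_part))"
proof -
  have subs: "star_part \<subseteq> curve" "band_part \<subseteq> curve" "upper_band \<subseteq> band_part" "lower_band \<subseteq> band_part"
    by (auto simp: star_part_def band_part_def upper_band_def lower_band_def)
  have subt: "subtopology X S = top_of_set S" if "S \<subseteq> curve" for S
    using that unfolding X_def by (simp add: subtopology_subtopology Int_absorb1)
  show "openin X star_part"
  proof -
    have "open ((\<lambda>q::complex \<times> complex. 1 - fst q ^ (2*g)) -` (- \<real>\<^sub>\<le>\<^sub>0))"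
      by (intro continuous_open_vimage continuous_intros) (auto simp: closed_nonpos_Reals_complex open_Compl)
    moreover have "star_part = curve \<inter> (\<lambda>q. 1 - fst q ^ (2*g)) -` (- \<real>\<^sub>\<le>\<^sub>0)"
      by (auto simp: star_part_def)
    ultimately show ?thesis unfolding X_def by (metis openin_open_Int)
  qed
  show band_open: "openin X band_part"
  proof -
    have "open ((\<lambda>q::complex \<times> complex. fst q ^ (2*g)) -` (- \<real>\<^sub>\<le>\<^sub>0))"
      by (intro continuous_open_vimage continuous_intros) (auto simp: closed_nonpos_Reals_complex open_Compl)
    moreover have "band_part = curve \<inter> (\<lambda>q. fst q ^ (2*g)) -` (- \<real>\<^sub>\<le>\<^sub>0)"
      by (auto simp: band_part_def)
    ultimately show ?thesis unfolding X_def by (metis openin_open_Int)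
  qed
  have cont: "continuous_on band_part (\<lambda>q. Im (snd (band_coord q)))"
    by (intro continuous_intros continuous_on_band_coord)
  have "openin (top_of_set band_part) (band_part \<inter> (\<lambda>q. Im (snd (band_coord q))) -` {0<..})"
    "openin (top_of_set band_part) (band_part \<inter> (\<lambda>q. Im (snd (band_coord q))) -` {..<0})"
    by (intro continuous_openin_preimage_gen cont; simp)+
  moreover have "band_part \<inter> (\<lambda>q. Im (snd (band_coord q))) -` {0<..} = upper_band"
    "band_part \<inter> (\<lambda>q. Im (snd (band_coord q))) -` {..<0} = lower_band"
    by (auto simp: upper_band_def lower_band_def)
  ultimately show "openin X upper_band" "openin X lower_band"
    using openin_trans_full [OF _ band_open] subt [OF subs(2)] by metis+
  \<comment> \<open>The value x^(2g) cannot be at least 1 and at most 0 simultaneously.\<close>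
  show "star_part \<union> band_part = topspace X"
    by (auto simp: X_def star_part_def band_part_def complex_nonpos_Reals_iff)
  show "contractible_space (subtopology X star_part)"
    using contractible_star_part subt [OF subs(1)] by simp
  have "(0, 0) \<in> star_part" using g by (simp add: star_part_def hyperelliptic_curve_def zero_power)
  then show "star_part \<noteq> {}" by auto
  show "star_part \<inter> band_part = upper_band \<union> lower_band"
  proof -
    \<comment> \<open>On a band 1 - x^(2g) equals \<open>- w\<^sup>2\<close>, which is real and
      non-positive exactly for real w. So each cut is the real axis of its band.\<close>
    have "1 - fst q ^ (2*g) \<notin> \<real>\<^sub>\<le>\<^sub>0 \<longleftrightarrow> Im (snd (band_coord q)) \<noteq> 0" if "q \<in> band_part" for q
      using band_coord_snd_square [OF that, symmetric] minus_square_nonpos_Reals_iff by simp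
    then show ?thesis
      by (auto simp: star_part_def upper_band_def lower_band_def) (auto simp: band_part_def)
  qed
  show "disjnt upper_band lower_band" by (auto simp: disjnt_def upper_band_def lower_band_def)
  show "subtopology X band_part = top_of_set band_part" by (rule subt [OF subs(2)])
  have cb: "continuous_map (top_of_set band_part) (top_of_set unity_roots) band"
    using continuous_on_band band_in_unity_roots by auto
  have "hom_induced p (top_of_set S) {} (top_of_set band_part) {} id
     \<in> iso (homology_group p (top_of_set S)) (homology_group p (top_of_set band_part))"
    if "S \<subseteq> band_part" "hom_induced p (top_of_set S) {} (top_of_set unity_roots) {} band
     \<in> iso (homology_group p (top_of_set S)) (homology_group p (top_of_set unity_roots))" for S
    using iso_homology_inclusion_of_projections [OF cb iso_homology_band_parts(1), of p S] that
    by (simp add: subtopology_subtopology Int_absorb1)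
  then show "hom_induced p (subtopology X upper_band) {} (subtopology X band_part) {} id
        \<in> iso (homology_group p (subtopology X upper_band)) (homology_group p (subtopology X band_part))"
    "hom_induced p (subtopology X lower_band) {} (subtopology X band_part) {} id
        \<in> iso (homology_group p (subtopology X lower_band)) (homology_group p (subtopology X band_part))"
    using subs iso_homology_band_parts(2,3) by (simp_all add: subt)
qed

text \<open>Each of the 2g bands counts as one point, so the curve has the homology of a wedge of 2g
  circles.\<close>

lemma homology_curve:
  "reduced_homology_group p (top_of_set curve) \<cong> homology_group (p - 1) (discrete_topology unity_roots)"
proof -
  have "reduced_homology_group p (top_of_set curve) \<cong> homology_group (p - 1) (subtopology (top_of_set curve) band_part)"
    by (rule isomorphic_reduced_homology_two_sided_cover [OF two_sided_cover_curve(1-9,11-12)])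
  moreover have "homology_group (p - 1) (top_of_set band_part) \<cong> homology_group (p - 1) (top_of_set unity_roots)"
    by (rule is_isoI [OF iso_homology_band_parts(1)])
  ultimately show ?thesis
    unfolding two_sided_cover_curve(10) top_of_set_finite [OF finite_unity_roots] by (rule iso_trans)
qed

lemma second_homology_curve: "trivial_group (homology_group 2 (top_of_set curve))"
  using homology_curve [of 2] trivial_homology_discrete_topology [of 1 unity_roots] isomorphic_group_triviality
  by (fastforce simp: un_reduced_homology_group)

lemma first_homology_curve: "homology_group 1 (top_of_set curve) \<cong> free_Abelian_group {..<2*g}"
  using iso_trans [OF homology_curve [of 1, simplified] zeroth_homology_discrete_topology [OF finite_unity_roots]]
  by (simp add: un_reduced_homology_group card_unity_roots)

lemma sheet_swap_first_homology_curve: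
  assumes c: "c \<in> carrier (homology_group 1 (top_of_set curve))"
  shows "hom_induced 1 (top_of_set curve) {} (top_of_set curve) {} sheet_swap c
       = inv\<^bsub>homology_group 1 (top_of_set curve)\<^esub> c"
proof (rule hom_induced_swap_two_sided_cover [OF two_sided_cover_curve(1-9,11-12)])
  have "continuous_on curve sheet_swap" by (intro continuous_intros)
  moreover have "sheet_swap \<in> curve \<rightarrow> curve" by (auto simp: hyperelliptic_curve_def)
  ultimately show "continuous_map (top_of_set curve) (top_of_set curve) sheet_swap" by simp
  show "sheet_swap \<in> star_part \<rightarrow> star_part" "sheet_swap \<in> band_part \<rightarrow> band_part"
    by (auto simp: star_part_def band_part_def hyperelliptic_curve_def)
  then show "sheet_swap \<in> upper_band \<rightarrow> lower_band" "sheet_swap \<in> lower_band \<rightarrow> upper_band"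
    by (auto simp: upper_band_def lower_band_def sheet_swap_band_coord Pi_iff)
  show "c \<in> carrier (reduced_homology_group 1 (top_of_set curve))"
    using c by (simp add: un_reduced_homology_group)
  fix d assume d: "d \<in> carrier (homology_group (1 - 1) (subtopology (top_of_set curve) band_part))"
  let ?N = "top_of_set band_part" and ?R = "top_of_set unity_roots"
  have cs: "continuous_map ?N ?N sheet_swap"
    using \<open>sheet_swap \<in> band_part \<rightarrow> band_part\<close> by (auto intro!: continuous_intros)
  have cb: "continuous_map ?N ?R band"
    using continuous_on_band band_in_unity_roots by auto
  let ?s = "hom_induced 0 ?N {} ?N {} sheet_swap" and ?b = "hom_induced 0 ?N {} ?R {} band"
  \<comment> \<open>The sheet swap maps every band to itself, and \<open>H\<^sub>0\<close> of the
    band part is detected by the map to the roots of unity; hence the swap is trivial on it.\<close>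
  have "?b (?s d) = hom_induced 0 ?N {} ?R {} (band \<circ> sheet_swap) d"
    using cs cb by (simp add: hom_induced_compose')
  also have "\<dots> = ?b d"
    by (simp add: o_def sheet_swap_band_coord)
  finally have "?b (?s d) = ?b d" .
  moreover have "inj_on ?b (carrier (homology_group 0 ?N))"
    using iso_homology_band_parts(1) [of 0] by (simp add: iso_def bij_betw_def)
  ultimately show "hom_induced (1 - 1) (subtopology (top_of_set curve) band_part) {}
       (subtopology (top_of_set curve) band_part) {} sheet_swap d = d"
    using d unfolding two_sided_cover_curve(10) by (simp add: inj_on_def hom_induced_carrier)
qed

end

section \<open>The compactified curve\<close>

text \<open>Open sets of the compactification are of two kinds. Those without the added point are
  handled by continuity of the finite part; for complements of closed compact sets,
  \<open>cl\<close> states that the preimages of such sets are closed.\<close>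

lemma continuous_map_into_Alexandroff:
  assumes im: "f \<in> topspace A \<rightarrow> insert None (Some ` topspace Y)"
    and op: "openin A {a \<in> topspace A. f a \<noteq> None}"
    and cont: "continuous_map (subtopology A {a \<in> topspace A. f a \<noteq> None}) Y (\<lambda>a. the (f a))"
    and cl: "\<And>C. \<lbrakk>compactin Y C; closedin Y C\<rbrakk> \<Longrightarrow> closedin A {a \<in> topspace A. f a \<in> Some ` C}"
  shows "continuous_map A (Alexandroff_compactification Y) f"
  unfolding continuous_map_def
proof (intro conjI allI impI)
  show "f \<in> topspace A \<rightarrow> topspace (Alexandroff_compactification Y)"
    using im by simp
  fix T assume "openin (Alexandroff_compactification Y) T"
  then consider T' where "openin Y T'" "T = Some ` T'"
    | C where "compactin Y C" "closedin Y C" "T = insert None (Some ` (topspace Y - C))"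
    unfolding openin_Alexandroff_compactification by blast
  then show "openin A {x \<in> topspace A. f x \<in> T}"
  proof cases
    case 1
    let ?A = "{a \<in> topspace A. f a \<noteq> None}"
    have "openin (subtopology A ?A) {a \<in> topspace (subtopology A ?A). the (f a) \<in> T'}"
      by (rule openin_continuous_map_preimage [OF cont 1(1)])
    moreover have "{a \<in> topspace (subtopology A ?A). the (f a) \<in> T'} = {x \<in> topspace A. f x \<in> T}"
      using 1(2) by force
    ultimately show ?thesis using op openin_open_subtopology by metis
  next
    case 2
    have "{x \<in> topspace A. f x \<in> T} = topspace A - {a \<in> topspace A. f a \<in> Some ` C}"
      using im 2 by (auto simp: image_iff Pi_iff)
    then show ?thesis using cl [OF 2(1,2)] by (simp add: openin_diff)
  qed
qed

lemma homeomorphic_map_Some: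
  assumes "S \<subseteq> topspace Y"
  shows "homeomorphic_map (subtopology Y S) (subtopology (Alexandroff_compactification Y) (Some ` S)) Some"
proof -
  let ?X = "Alexandroff_compactification Y"
  have "homeomorphic_map (subtopology Y S) (subtopology (subtopology ?X (Some ` topspace Y)) (Some ` S)) Some"
    by (rule homeomorphic_map_subtopologies) (use embedding_map_Some [of Y] assms in \<open>auto simp: embedding_map_def\<close>)
  moreover have "Some ` topspace Y \<inter> Some ` S = Some ` S" using assms by auto
  ultimately show ?thesis by (simp add: subtopology_subtopology)
qed

lemma homeomorphic_map_map_option_Alexandroff:
  assumes "homeomorphic_maps Y Y f g"
  shows "homeomorphic_map (Alexandroff_compactification Y) (Alexandroff_compactification Y) (map_option f)"
proof -
  \<comment> \<open>Generalised over the pair of inverse maps, so that it applies in both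
    directions.\<close>
  have "continuous_map (Alexandroff_compactification Y) (Alexandroff_compactification Y) (map_option f)"
    if fg: "homeomorphic_maps Y Y f g" for f g
  proof (rule continuous_map_into_Alexandroff)
    let ?X = "Alexandroff_compactification Y"
    have f: "continuous_map Y Y f" and g: "continuous_map Y Y g"
      and gf: "\<And>y. y \<in> topspace Y \<Longrightarrow> g (f y) = y" and fg: "\<And>y. y \<in> topspace Y \<Longrightarrow> f (g y) = y"
      using fg by (auto simp: homeomorphic_maps_def)
    show "map_option f \<in> topspace ?X \<rightarrow> insert None (Some ` topspace Y)"
      using continuous_map_image_subset_topspace [OF f] by auto
    have eq: "{a \<in> topspace ?X. map_option f a \<noteq> None} = Some ` topspace Y" by auto
    show "openin ?X {a \<in> topspace ?X. map_option f a \<noteq> None}" unfolding eq by simp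
    have "homeomorphic_map Y (subtopology ?X (Some ` topspace Y)) Some"
      using homeomorphic_map_Some [of "topspace Y" Y] by simp
    then obtain k where k: "homeomorphic_maps Y (subtopology ?X (Some ` topspace Y)) Some k"
      unfolding homeomorphic_map_maps by blast
    then have "continuous_map (subtopology ?X (Some ` topspace Y)) Y k"
      by (simp add: homeomorphic_maps_def)
    then have "continuous_map (subtopology ?X (Some ` topspace Y)) Y the"
      by (rule continuous_map_eq) (use k in \<open>auto simp: homeomorphic_maps_def\<close>)
    then have "continuous_map (subtopology ?X (Some ` topspace Y)) Y (f \<circ> the)"
      using f by (rule continuous_map_compose)
    then show "continuous_map (subtopology ?X {a \<in> topspace ?X. map_option f a \<noteq> None}) Y (\<lambda>a. the (map_option f a))"
      unfolding eq by (rule continuous_map_eq) auto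
    fix C assume C: "compactin Y C" "closedin Y C"
    have "{a \<in> topspace ?X. map_option f a \<in> Some ` C} = Some ` {y \<in> topspace Y. f y \<in> C}" by auto
    \<comment> \<open>The preimage of a compact set under \<open>f\<close> is its image under the
      inverse, hence compact.\<close>
    moreover have "{y \<in> topspace Y. f y \<in> C} = g ` C"
      using gf fg closedin_subset [OF C(2)] continuous_map_image_subset_topspace [OF g] by (force simp: image_iff)
    moreover have "compactin Y (g ` C)" using image_compactin [OF C(1) g] .
    moreover have "closedin Y {y \<in> topspace Y. f y \<in> C}"
      by (rule closedin_continuous_map_preimage [OF f C(2)])
    ultimately show "closedin ?X {a \<in> topspace ?X. map_option f a \<in> Some ` C}" by simp
  qed
  then have "homeomorphic_maps (Alexandroff_compactification Y) (Alexandroff_compactification Y) (map_option f) (map_option g)"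
    using assms homeomorphic_maps_sym [of Y Y f g] unfolding homeomorphic_maps_def by (auto simp: option.map_comp)
  then show ?thesis by (rule homeomorphic_maps_imp_map)
qed

lemma locally_euclidean_2_complex_charts:
  assumes "\<And>x. x \<in> topspace X \<Longrightarrow> \<exists>U. openin X U \<and> x \<in> U \<and>
        (\<exists>V::complex set. open V \<and> subtopology X U homeomorphic_space top_of_set V)"
  shows "locally_euclidean_2 X"
  unfolding locally_euclidean_2_def
proof
  fix x assume "x \<in> topspace X"
  then obtain U and V :: "complex set" where U: "openin X U" "x \<in> U" and V: "open V" "subtopology X U homeomorphic_space top_of_set V"
    using assms by blast
  have "DIM(complex) = DIM(real^2)" by simp
  then obtain f :: "complex \<Rightarrow> real^2" and g where fg: "linear f" "linear g"
    "\<And>x. g (f x) = x" "\<And>y. f (g y) = y"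
    by (rule isomorphisms_UNIV_UNIV) blast
  have cont: "continuous_on S f" "continuous_on T g" for S T
    using fg by (auto simp: linear_continuous_on linear_conv_bounded_linear)
  have "homeomorphism V (f ` V) f g"
    unfolding homeomorphism_def using fg cont by (auto simp: image_image)
  then have "top_of_set V homeomorphic_space top_of_set (f ` V)"
    unfolding homeomorphic_space_def homeomorphic_maps_def homeomorphism_def
    by (intro exI [of _ f] exI [of _ g]) auto
  moreover have "open (f ` V)"
  proof -
    have "f ` V = g -` V" using fg(3) by (auto intro!: image_eqI [of _ f, OF fg(4) [symmetric]])
    then show ?thesis using V(1) cont(2) [of UNIV] by (simp add: continuous_open_vimage continuous_on_eq_continuous_at)
  qed
  ultimately show "\<exists>U. openin X U \<and> x \<in> U \<and> (\<exists>V::(real^2) set. open V \<and> subtopology X U homeomorphic_space top_of_set V)"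
    using U V homeomorphic_space_trans by metis
qed

context hyperelliptic
begin

lemma closed_curve: "closed curve"
  unfolding hyperelliptic_curve_def by (intro closed_Collect_eq continuous_intros)

text \<open>On the curve y is bounded in terms of x, so the projection to x is proper. It follows
  that large x means closeness to the point at infinity.\<close>

lemma compact_curve_bounded: "compact {q \<in> curve. norm (fst q) \<le> r}"
proof -
  have "closed {q \<in> curve. norm (fst q) \<le> r}"
  proof -
    have "{q \<in> curve. norm (fst q) \<le> r} = curve \<inter> {q. norm (fst q) \<le> r}" by auto
    then show ?thesis by (auto intro!: closed_Int closed_curve closed_Collect_le continuous_intros)
  qed
  moreover have "bounded {q \<in> curve. norm (fst q) \<le> r}"
  proof (rule bounded_subset)
    show "{q \<in> curve. norm (fst q) \<le> r} \<subseteq> cball 0 r \<times> cball 0 (1 + r * (r ^ (2*g) + 1))"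
    proof
      fix q assume "q \<in> {q \<in> curve. norm (fst q) \<le> r}"
      then have q: "(snd q)\<^sup>2 = fst q * (fst q ^ (2*g) - 1)" "norm (fst q) \<le> r"
        by (auto simp: hyperelliptic_curve_def)
      then have "r \<ge> 0" using norm_ge_zero order_trans by blast
      have "(norm (snd q))\<^sup>2 = norm (fst q) * norm (fst q ^ (2*g) - 1)"
        using q(1) by (metis norm_mult norm_power)
      also have "\<dots> \<le> r * (r ^ (2*g) + 1)"
      proof (rule mult_mono)
        have "norm (fst q ^ (2*g) - 1) \<le> norm (fst q) ^ (2*g) + 1"
          by (metis norm_one norm_power norm_triangle_ineq4)
        also have "\<dots> \<le> r ^ (2*g) + 1" using q(2) by (simp add: power_mono)
        finally show "norm (fst q ^ (2*g) - 1) \<le> r ^ (2*g) + 1" .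
      qed (use q \<open>r \<ge> 0\<close> in auto)
      finally have *: "(norm (snd q))\<^sup>2 \<le> r * (r ^ (2*g) + 1)" .
      \<comment> \<open>From \<open>(t - 1)\<^sup>2 \<ge> 0\<close>, which spares a square root in
        the radius.\<close>
      have "norm (snd q) \<le> 1 + (norm (snd q))\<^sup>2"
        using zero_le_power2 [of "norm (snd q) - 1"]
        by (simp add: power2_diff) (use norm_ge_zero [of "snd q"] in linarith)
      with * have "norm (snd q) \<le> 1 + r * (r ^ (2*g) + 1)" by linarith
      then show "q \<in> cball 0 r \<times> cball 0 (1 + r * (r ^ (2*g) + 1))"
        using q(2) by (auto simp: mem_Times_iff)
    qed
  qed (intro bounded_Times bounded_cball)
  ultimately show ?thesis by (simp add: compact_eq_bounded_closed)
qed

section \<open>The disc chart at infinity\<close>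

abbreviation "surface \<equiv> Alexandroff_compactification (top_of_set curve)"

text \<open>The parameter at infinity is \<open>z = x\<^bsup>-1/2\<^esup>\<close>, with the sign determined by \<open>y\<close>.\<close>

definition "inf_point z = (1 / z\<^sup>2, csqrt (1 - z ^ (4*g)) / z ^ (2*g + 1))"
text \<open>With s the principal root of 1 - x^(-2g), the parametrisation gives y = s / z^(2g+1) and
  x^g = z^(-2g), so s x^g / y is z. The odd exponent of z in y is what separates z from -z and makes
  one disc cover both sheets.\<close>

definition "inf_coord q = csqrt (1 - 1 / fst q ^ (2*g)) * fst q ^ g / snd q"
definition "inf_chart z = (if z = 0 then None else Some (inf_point z))"
definition "inf_nbhd = insert None (Some ` {q \<in> curve. 1 < norm (fst q)})"

lemma one_minus_notin_nonpos_Reals: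
  fixes w :: complex
  assumes "norm w < 1"
  shows "1 - w \<notin> \<real>\<^sub>\<le>\<^sub>0"
proof
  assume "1 - w \<in> \<real>\<^sub>\<le>\<^sub>0"
  then have "1 \<le> Re w" by (simp add: complex_nonpos_Reals_iff)
  also have "\<dots> \<le> norm w" by (rule complex_Re_le_cmod)
  finally show False using assms by simp
qed

lemma norm_power_lt_1: "norm (z::complex) < 1 \<Longrightarrow> norm (z ^ (4*g)) < 1"
  using g by (simp add: norm_power power_less_one_iff)

lemma inf_point_in:
  assumes "z \<noteq> 0" "norm z < 1"
  shows "inf_point z \<in> {q \<in> curve. 1 < norm (fst q)}"
proof -
  have "(1 / z\<^sup>2) ^ (2*g) = 1 / z ^ (4*g)" by (simp add: power_divide flip: power_mult)
  moreover have "(z ^ (2*g+1))\<^sup>2 = z ^ (4*g) * z\<^sup>2"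
  proof -
    have "(2*g+1) * 2 = 4*g + 2" by simp
    then show ?thesis by (metis power_mult power_add)
  qed
  ultimately have "inf_point z \<in> curve"
    using assms by (simp add: inf_point_def hyperelliptic_curve_def power_divide field_simps)
  moreover have "1 < norm (1 / z\<^sup>2)"
    using assms by (simp add: norm_divide norm_power power_less_one_iff)
  ultimately show ?thesis by (simp add: inf_point_def)
qed

lemma inf_coord_inf_point:
  assumes "z \<noteq> 0" "norm z < 1"
  shows "inf_coord (inf_point z) = z"
proof -
  have "csqrt (1 - z ^ (4*g)) \<noteq> 0"
    using one_minus_notin_nonpos_Reals [OF norm_power_lt_1 [OF assms(2)]] by auto
  moreover have "(1 / z\<^sup>2) ^ (2*g) = 1 / z ^ (4*g)" "(1 / z\<^sup>2) ^ g = 1 / z ^ (2*g)"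
    by (simp_all add: power_divide flip: power_mult)
  ultimately show ?thesis
    using assms by (simp add: inf_coord_def inf_point_def)
qed

lemma inf_point_inf_coord:
  assumes "q \<in> curve" "1 < norm (fst q)"
  shows "inf_coord q \<noteq> 0" "norm (inf_coord q) < 1" "inf_point (inf_coord q) = q" "snd q \<noteq> 0"
proof -
  obtain x y where q: "q = (x, y)" by (cases q)
  have y2: "y\<^sup>2 = x * (x ^ (2*g) - 1)" and x: "norm x > 1" "x \<noteq> 0"
    using assms by (auto simp: q curve_iff)
  have "norm (x ^ (2*g)) > 1" using x g by (simp add: norm_power one_less_power)
  then have x1: "x ^ (2*g) \<noteq> 1" by auto
  then have y: "y \<noteq> 0" using y2 x by auto
  then show "snd q \<noteq> 0" by (simp add: q)
  define s where "s = csqrt (1 - 1 / x ^ (2*g))"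
  have s2: "s\<^sup>2 = 1 - 1 / x ^ (2*g)" by (simp add: s_def)
  then have s: "s \<noteq> 0" using x x1 by auto
  define z where "z = s * x ^ g / y"
  have z: "inf_coord q = z" by (simp add: inf_coord_def q z_def s_def)
  have z0: "z \<noteq> 0" using s x y by (simp add: z_def)
  have "z\<^sup>2 = s\<^sup>2 * x ^ (2*g) / y\<^sup>2"
    by (simp add: z_def power_divide power_mult_distrib flip: power_mult) (simp add: mult.commute)
  also have "\<dots> = 1 / x"
    unfolding s2 y2 using x x1 by (simp add: field_simps)
  finally have z2: "z\<^sup>2 = 1 / x" .
  then have "(norm z)\<^sup>2 < 1" using x by (metis divide_less_eq_1_pos norm_divide norm_one norm_power zero_less_norm_iff)
  then have "norm z < 1" by (simp add: power_less_one_iff)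
  have z4: "z ^ (4*g) = 1 / x ^ (2*g)"
  proof -
    have "z ^ (4*g) = (z\<^sup>2) ^ (2*g)" by (simp flip: power_mult)
    then show ?thesis by (simp add: z2 power_divide)
  qed
  have "z ^ (2*g+1) = (z\<^sup>2) ^ g * z" by (simp flip: power_mult)
  also have "\<dots> = s / y" unfolding z2 using x by (simp add: z_def power_divide)
  finally have "s / z ^ (2*g+1) = y" using s y by simp
  then have "inf_point z = q"
    by (simp add: inf_point_def z2 z4 q flip: s_def)
  with z z0 \<open>norm z < 1\<close> show "inf_coord q \<noteq> 0" "norm (inf_coord q) < 1" "inf_point (inf_coord q) = q" by auto
qed

lemma norm_inf_coord:
  assumes "q \<in> curve" "1 < norm (fst q)"
  shows "norm (fst q) * (norm (inf_coord q))\<^sup>2 = 1"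
proof -
  have "fst q = 1 / (inf_coord q)\<^sup>2"
    using inf_point_inf_coord(3) [OF assms] by (metis fst_conv inf_point_def)
  then show ?thesis
    using inf_point_inf_coord(1) [OF assms] by (simp add: norm_divide norm_power)
qed

lemma continuous_on_inf_point: "continuous_on (ball 0 1 - {0}) inf_point"
  unfolding inf_point_def
  by (intro continuous_intros continuous_on_csqrt') (use one_minus_notin_nonpos_Reals [OF norm_power_lt_1] in auto)

lemma continuous_on_inf_coord: "continuous_on {q \<in> curve. 1 < norm (fst q)} inf_coord"
proof -
  have "fst q \<noteq> 0" "1 - 1 / fst q ^ (2*g) \<notin> \<real>\<^sub>\<le>\<^sub>0" if "1 < norm (fst q)" for q :: "complex \<times> complex"
  proof -
    show "fst q \<noteq> 0" using that by auto
    have "norm (fst q ^ (2*g)) > 1" using that g by (simp add: norm_power one_less_power)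
    then show "1 - 1 / fst q ^ (2*g) \<notin> \<real>\<^sub>\<le>\<^sub>0"
      by (intro one_minus_notin_nonpos_Reals)
        (metis divide_less_eq_1_pos norm_divide norm_one order_less_trans zero_less_one)
  qed
  then show ?thesis
    unfolding inf_coord_def
    by (intro continuous_intros continuous_on_csqrt') (use inf_point_inf_coord(4) in auto)
qed

lemma openin_inf_nbhd_finite_part: "openin (top_of_set curve) {q \<in> curve. 1 < norm (fst q)}"
proof -
  have "open {q::complex \<times> complex. 1 < norm (fst q)}"
    by (intro open_Collect_less continuous_intros)
  moreover have "{q \<in> curve. 1 < norm (fst q)} = curve \<inter> {q. 1 < norm (fst q)}" by auto
  ultimately show ?thesis by (metis openin_open_Int)
qed

lemma continuous_map_inf_chart: "continuous_map (top_of_set (ball 0 1)) surface inf_chart"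
proof (rule continuous_map_into_Alexandroff)
  let ?A = "top_of_set (ball (0::complex) 1)"
  show "inf_chart \<in> topspace ?A \<rightarrow> insert None (Some ` topspace (top_of_set curve))"
    using inf_point_in by (auto simp: inf_chart_def)
  have eq: "{a \<in> topspace ?A. inf_chart a \<noteq> None} = ball 0 1 - {0}"
    by (auto simp: inf_chart_def)
  show "openin ?A {a \<in> topspace ?A. inf_chart a \<noteq> None}"
    unfolding eq by (auto intro: open_subset)
  have "continuous_map (top_of_set (ball 0 1 - {0})) (top_of_set curve) inf_point"
    using continuous_on_inf_point inf_point_in by auto
  then have "continuous_map (top_of_set (ball 0 1 - {0})) (top_of_set curve) (\<lambda>a. the (inf_chart a))"
    by (rule continuous_map_eq) (simp add: inf_chart_def)
  moreover have "subtopology ?A (ball 0 1 - {0}) = top_of_set (ball 0 1 - {0})"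
    by (simp add: subtopology_subtopology Int_absorb1)
  ultimately show "continuous_map (subtopology ?A {a \<in> topspace ?A. inf_chart a \<noteq> None}) (top_of_set curve) (\<lambda>a. the (inf_chart a))"
    unfolding eq by simp
  fix C assume C: "compactin (top_of_set curve) C"
  then have "compact C" "C \<subseteq> curve" by (auto simp: compactin_subtopology)
  then obtain B where B: "B > 0" "\<And>q. q \<in> C \<Longrightarrow> norm q \<le> B"
    using compact_imp_bounded bounded_pos by metis
  \<comment> \<open>A bound \<open>B\<close> for \<open>C\<close> forces
    \<open>1 / |z|\<^sup>2 \<le> B\<close> on the preimage. The set \<open>K\<close> is closed in
    the disc and avoids 0, so continuity of \<open>inf_point\<close> on it suffices.\<close>
  define K where "K = {z \<in> ball (0::complex) 1. 1 \<le> B * (norm z)\<^sup>2}"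
  have "closedin (top_of_set K) (K \<inter> inf_point -` C)"
  proof (rule continuous_closedin_preimage)
    show "continuous_on K inf_point"
      by (rule continuous_on_subset [OF continuous_on_inf_point]) (auto simp: K_def)
    show "closed C" using \<open>compact C\<close> by (rule compact_imp_closed)
  qed
  moreover have "closedin (top_of_set (ball 0 1)) K"
  proof -
    have "closed {z::complex. 1 \<le> B * (norm z)\<^sup>2}"
      by (intro closed_Collect_le continuous_intros)
    moreover have "K = ball 0 1 \<inter> {z. 1 \<le> B * (norm z)\<^sup>2}" by (auto simp: K_def)
    ultimately show ?thesis by (metis closedin_closed_Int)
  qed
  ultimately have "closedin (top_of_set (ball 0 1)) (K \<inter> inf_point -` C)"
    using closedin_trans by blast
  moreover have "K \<inter> inf_point -` C = {a \<in> topspace ?A. inf_chart a \<in> Some ` C}"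
  proof -
    have "1 \<le> B * (norm z)\<^sup>2" if "z \<noteq> 0" "inf_point z \<in> C" for z
    proof -
      have "norm (1 / z\<^sup>2) \<le> norm (inf_point z)" unfolding inf_point_def by (rule norm_fst_le)
      also have "\<dots> \<le> B" using B that by blast
      finally show ?thesis using that by (simp add: norm_divide norm_power field_simps)
    qed
    moreover have "z \<noteq> 0" if "z \<in> K" for z using that by (auto simp: K_def)
    ultimately show ?thesis by (auto simp: K_def inf_chart_def)
  qed
  ultimately show "closedin ?A {a \<in> topspace ?A. inf_chart a \<in> Some ` C}" by simp
qed

lemma image_inf_chart: "inf_chart ` ball 0 1 = inf_nbhd"
proof
  show "inf_chart ` ball 0 1 \<subseteq> inf_nbhd"
    using inf_point_in by (auto simp: inf_chart_def inf_nbhd_def)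
  show "inf_nbhd \<subseteq> inf_chart ` ball 0 1"
  proof
    fix a assume "a \<in> inf_nbhd"
    then consider "a = None" | q where "a = Some q" "q \<in> curve" "1 < norm (fst q)"
      by (auto simp: inf_nbhd_def)
    then show "a \<in> inf_chart ` ball 0 1"
    proof cases
      case 1
      then show ?thesis by (intro image_eqI [of _ _ 0]) (auto simp: inf_chart_def)
    next
      case 2
      then show ?thesis
        using inf_point_inf_coord [OF 2(2,3)] by (intro image_eqI [of _ _ "inf_coord q"]) (auto simp: inf_chart_def)
    qed
  qed
qed

lemma inj_on_inf_chart: "inj_on inf_chart (ball 0 1)"
  by (rule inj_onI) (auto simp: inf_chart_def split: if_splits dest: arg_cong [where f = inf_coord] simp: inf_coord_inf_point)

lemma open_map_inf_chart: "open_map (top_of_set (ball 0 1)) surface inf_chart"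
  unfolding open_map_def
proof (intro allI impI)
  fix T assume "openin (top_of_set (ball (0::complex) 1)) T"
  then have T: "open T" "T \<subseteq> ball 0 1" by (auto simp: openin_open_eq)
  let ?E = "{q \<in> curve. 1 < norm (fst q)}"
  have im: "inf_point ` (T - {0}) = ?E \<inter> inf_coord -` T"
  proof
    show "inf_point ` (T - {0}) \<subseteq> ?E \<inter> inf_coord -` T"
    proof
      fix q assume "q \<in> inf_point ` (T - {0})"
      then obtain z where "z \<in> T" "z \<noteq> 0" "q = inf_point z" by blast
      moreover have "norm z < 1" using \<open>z \<in> T\<close> T(2) by auto
      ultimately show "q \<in> ?E \<inter> inf_coord -` T"
        using inf_point_in [of z] inf_coord_inf_point [of z] by simp
    qed
    show "?E \<inter> inf_coord -` T \<subseteq> inf_point ` (T - {0})"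
      using inf_point_inf_coord by (force simp: image_iff)
  qed
  have "openin (top_of_set ?E) (?E \<inter> inf_coord -` T)"
    by (rule continuous_openin_preimage_gen [OF continuous_on_inf_coord T(1)])
  then have op: "openin (top_of_set curve) (inf_point ` (T - {0}))"
    unfolding im using openin_inf_nbhd_finite_part openin_trans by blast
  show "openin surface (inf_chart ` T)"
  proof (cases "0 \<in> T")
    case False
    then have "inf_chart ` T = Some ` inf_point ` (T - {0})"
      by (auto simp: inf_chart_def image_iff)
    with op show ?thesis by simp
  next
    case True
    \<comment> \<open>An image containing the point at infinity is open if the rest of the curve is
      closed and compact.\<close>
    define C where "C = curve - inf_point ` (T - {0})"
    have sub: "inf_point ` (T - {0}) \<subseteq> curve" using openin_subset [OF op] by simp
    have "inf_chart ` T = insert None (Some ` (curve - C))"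
      using True sub by (auto simp: inf_chart_def image_iff C_def)
    moreover have clC: "closedin (top_of_set curve) C"
      using op unfolding C_def by (metis closedin_diff closedin_topspace topspace_euclidean_subtopology)
    moreover have "compactin (top_of_set curve) C"
    proof -
      obtain e where e: "e > 0" "ball 0 e \<subseteq> T" using T(1) True openE by blast
      \<comment> \<open>The inequality \<open>|z| < e\<close> amounts to
        \<open>|x| > 1 / e\<^sup>2\<close>; the maximum with 1 keeps x in the range where
        \<open>inf_coord\<close> inverts the chart.\<close>
      define r where "r = max 1 (1 / e\<^sup>2)"
      have "C \<subseteq> {q \<in> curve. norm (fst q) \<le> r}"
      proof
        fix q assume q: "q \<in> C"
        show "q \<in> {q \<in> curve. norm (fst q) \<le> r}"
        proof (rule ccontr)
          assume "\<not> ?thesis"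
          then have 1: "norm (fst q) > 1" "norm (fst q) > 1 / e\<^sup>2" "q \<in> curve" using q by (auto simp: r_def C_def)
          have "1 = norm (fst q) * (norm (inf_coord q))\<^sup>2" using norm_inf_coord 1 by simp
          moreover have "norm (fst q) * e\<^sup>2 > 1" using 1(2) e by (simp add: field_simps)
          ultimately have "(norm (inf_coord q))\<^sup>2 < e\<^sup>2"
            using 1(1) by (metis mult_less_cancel_left_pos less_trans zero_less_one)
          then have "norm (inf_coord q) < e" using e power2_less_imp_less by fastforce
          then have "inf_coord q \<in> T" using e by auto
          then have "q \<in> inf_point ` (T - {0})" unfolding im using 1 by simp
          with q show False by (simp add: C_def)
        qed
      qed
      moreover have "closed C" using clC closed_curve closedin_closed_trans by blast
      ultimately have "compact C"
        using compact_curve_bounded [of r] by (metis compact_Int_closed inf.absorb_iff2)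
      then show ?thesis using C_def by (auto simp: compactin_subtopology)
    qed
    ultimately show ?thesis
      unfolding openin_Alexandroff_compactification by auto
  qed
qed

lemma openin_inf_nbhd: "openin surface inf_nbhd"
  using open_map_inf_chart image_inf_chart by (metis open_map_def openin_subtopology_self)

lemma homeomorphic_map_inf_chart: "homeomorphic_map (top_of_set (ball 0 1)) (subtopology surface inf_nbhd) inf_chart"
proof (rule bijective_open_imp_homeomorphic_map)
  show "continuous_map (top_of_set (ball 0 1)) (subtopology surface inf_nbhd) inf_chart"
    using continuous_map_inf_chart image_inf_chart by (auto simp: continuous_map_in_subtopology)
  show "open_map (top_of_set (ball 0 1)) (subtopology surface inf_nbhd) inf_chart"
    using open_map_inf_chart image_inf_chart openin_inf_nbhd openin_subset
    by (fastforce simp: open_map_def openin_open_subtopology)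
  show "inf_chart ` topspace (top_of_set (ball 0 1)) = topspace (subtopology surface inf_nbhd)"
    using image_inf_chart openin_subset [OF openin_inf_nbhd] by auto
  show "inj_on inf_chart (topspace (top_of_set (ball 0 1)))"
    using inj_on_inf_chart by simp
qed

lemma Hausdorff_surface: "Hausdorff_space surface"
  unfolding Hausdorff_space_Alexandroff_compactification
proof
  show "Hausdorff_space (top_of_set curve)" by (simp add: Hausdorff_space_subtopology)
  show "locally_compact_space (top_of_set curve)"
    by (rule locally_compact_space_closed_subset) (use closed_curve in \<open>auto simp: locally_compact_space_euclidean\<close>)
qed

sublocale inf: disc_chart surface None inf_nbhd inf_chart
proof
  show "openin surface inf_nbhd" by (rule openin_inf_nbhd)
  show "homeomorphic_map (top_of_set (ball 0 1)) (subtopology surface inf_nbhd) inf_chart"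
    by (rule homeomorphic_map_inf_chart)
  show "inf_chart 0 = None" by (simp add: inf_chart_def)
  show "closedin surface {None}"
    using Hausdorff_surface by (simp add: closedin_Hausdorff_sing_eq)
qed

end

section \<open>Transport along homeomorphisms\<close>

text \<open>The image receives its topology through the inverse of \<open>e\<close>, independently
  of any topology of the target type. This moves the surface onto a set of reals.\<close>

lemma homeomorphic_maps_pullback_topology:
  assumes "inj_on e (topspace X)"
  shows "homeomorphic_maps X (pullback_topology (e ` topspace X) (inv_into (topspace X) e) X) e (inv_into (topspace X) e)"
    (is "homeomorphic_maps X ?Y e ?d")
proof -
  have de: "?d (e x) = x" if "x \<in> topspace X" for x using assms that by simp
  have dX: "?d y \<in> topspace X" if "y \<in> e ` topspace X" for y using that by (rule inv_into_into)
  have tY: "topspace ?Y = e ` topspace X"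
    using dX by (auto simp: topspace_pullback_topology)
  have "continuous_map X ?Y e"
    unfolding continuous_map_def
  proof (intro conjI allI impI)
    fix U assume "openin ?Y U"
    then obtain W where W: "openin X W" "U = ?d -` W \<inter> e ` topspace X"
      by (auto simp: openin_pullback_topology)
    have "e x \<in> U \<longleftrightarrow> x \<in> W" if "x \<in> topspace X" for x
      using that by (simp add: W(2) de)
    then have "{x \<in> topspace X. e x \<in> U} = W"
      using openin_subset [OF W(1)] by blast
    with W show "openin X {x \<in> topspace X. e x \<in> U}" by simp
  qed (use tY in auto)
  moreover have "continuous_map ?Y X ?d"
    unfolding continuous_map_def
  proof (intro conjI allI impI)
    fix U assume "openin X U"
    moreover have "{x \<in> topspace ?Y. ?d x \<in> U} = ?d -` U \<inter> e ` topspace X" using tY by auto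
    ultimately show "openin ?Y {x \<in> topspace ?Y. ?d x \<in> U}"
      by (auto simp: openin_pullback_topology)
  qed (use tY dX in auto)
  ultimately show ?thesis
    unfolding homeomorphic_maps_def tY by (simp add: de f_inv_into_f)
qed

lemma homeomorphic_space_closed_orientable_surface:
  assumes X: "closed_orientable_surface X g" and hom: "X homeomorphic_space Y"
  shows "closed_orientable_surface Y g"
proof -
  obtain e d where ed: "homeomorphic_maps X Y e d"
    using hom by (auto simp: homeomorphic_space_def)
  have "locally_euclidean_2 Y"
    unfolding locally_euclidean_2_def
  proof
    fix y assume y: "y \<in> topspace Y"
    have hd: "homeomorphic_map Y X d" and he: "homeomorphic_map X Y e"
      and ede: "\<And>y. y \<in> topspace Y \<Longrightarrow> e (d y) = y"
      using ed by (auto simp: homeomorphic_maps_map)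
    have "d y \<in> topspace X" using y hd homeomorphic_imp_surjective_map by blast
    then obtain U and V :: "(real^2) set" where U: "openin X U" "d y \<in> U"
      and V: "open V" "subtopology X U homeomorphic_space top_of_set V"
      using X unfolding closed_orientable_surface_def locally_euclidean_2_def by blast
    have "openin Y (e ` U)"
      using homeomorphic_map_openness_eq [OF he] U(1) by blast
    moreover have "y \<in> e ` U" using ede [OF y] U(2) by force
    moreover have "homeomorphic_map (subtopology X U) (subtopology Y (e ` U)) e"
      by (rule homeomorphic_map_subtopologies [OF he])
         (use openin_subset [OF U(1)] openin_subset [OF \<open>openin Y (e ` U)\<close>] in auto)
    then have "subtopology Y (e ` U) homeomorphic_space top_of_set V"
      using V(2) homeomorphic_map_imp_homeomorphic_space homeomorphic_space_sym homeomorphic_space_trans by blast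
    ultimately show "\<exists>U. openin Y U \<and> y \<in> U \<and> (\<exists>V::(real^2) set. open V \<and> subtopology Y U homeomorphic_space top_of_set V)"
      using V(1) by blast
  qed
  moreover have "Y homeomorphic_space X" using hom homeomorphic_space_sym by blast
  then have "homology_group p Y \<cong> homology_group p X" for p
    by (rule homeomorphic_space_imp_isomorphic_homology_groups)
  moreover have "topspace Y \<noteq> {}"
  proof -
    have "e ` topspace X = topspace Y"
      using ed by (meson homeomorphic_imp_surjective_map homeomorphic_maps_map)
    moreover have "topspace X \<noteq> {}" using X by (simp add: closed_orientable_surface_def)
    ultimately show ?thesis by blast
  qed
  moreover have "Hausdorff_space Y" "compact_space Y" "connected_space Y"
    using X homeomorphic_Hausdorff_space [OF hom] homeomorphic_compact_space [OF hom] homeomorphic_connected_space [OF hom]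
    by (simp_all add: closed_orientable_surface_def)
  moreover have "homology_group 2 X \<cong> integer_group" "homology_group 1 X \<cong> free_Abelian_group {..<2*g}"
    using X by (simp_all add: closed_orientable_surface_def)
  ultimately show ?thesis
    unfolding closed_orientable_surface_def by (meson iso_trans)
qed

lemma gpnf_action_conjugate:
  assumes act: "gpnf_action G X \<phi>" and ed: "homeomorphic_maps X Y e d"
  shows "gpnf_action G Y (\<lambda>h. e \<circ> \<phi> h \<circ> d)"
proof -
  have e: "homeomorphic_map X Y e" and d: "homeomorphic_map Y X d"
    and ec: "continuous_map X Y e" and dc: "continuous_map Y X d"
    and de: "\<And>x. x \<in> topspace X \<Longrightarrow> d (e x) = x" and ede: "\<And>y. y \<in> topspace Y \<Longrightarrow> e (d y) = y"
    using ed unfolding homeomorphic_maps_map by (auto intro: homeomorphic_imp_continuous_map)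
  have dX: "d y \<in> topspace X" if "y \<in> topspace Y" for y
    using that d homeomorphic_imp_surjective_map by blast
  have eY: "e x \<in> topspace Y" if "x \<in> topspace X" for x
    using that e homeomorphic_imp_surjective_map by blast
  have G: "group G" "finite (carrier G)" and one: "\<And>x. x \<in> topspace X \<Longrightarrow> \<phi> \<one>\<^bsub>G\<^esub> x = x"
    and opres: "\<And>h. h \<in> carrier G \<Longrightarrow> orientation_preserving_homeo X (\<phi> h)"
    and mult: "\<And>h k x. \<lbrakk>h \<in> carrier G; k \<in> carrier G; x \<in> topspace X\<rbrakk> \<Longrightarrow> \<phi> (h \<otimes>\<^bsub>G\<^esub> k) x = \<phi> h (\<phi> k x)"
    and faith: "\<And>h. \<lbrakk>h \<in> carrier G; \<forall>x\<in>topspace X. \<phi> h x = x\<rbrakk> \<Longrightarrow> h = \<one>\<^bsub>G\<^esub>"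
    and fixed: "\<And>h. h \<in> carrier G \<Longrightarrow> \<exists>x\<in>topspace X. \<phi> h x = x"
    using act by (auto simp: gpnf_action_def orient_pres_faithful_action_def)
  have \<phi>X: "\<phi> h x \<in> topspace X" if "h \<in> carrier G" "x \<in> topspace X" for h x
    using opres [OF that(1)] that(2) homeomorphic_imp_surjective_map
    unfolding orientation_preserving_homeo_def by blast
  have "orientation_preserving_homeo Y (e \<circ> \<phi> h \<circ> d)" if h: "h \<in> carrier G" for h
    unfolding orientation_preserving_homeo_def
  proof (intro conjI ballI)
    have \<phi>: "homeomorphic_map X X (\<phi> h)" using opres [OF h] by (simp add: orientation_preserving_homeo_def)
    then have \<phi>c: "continuous_map X X (\<phi> h)" by (rule homeomorphic_imp_continuous_map)
    show "homeomorphic_map Y Y (e \<circ> \<phi> h \<circ> d)"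
      using homeomorphic_map_compose [OF homeomorphic_map_compose [OF d \<phi>] e] by (simp add: o_assoc)
    fix c assume c: "c \<in> carrier (homology_group 2 Y)"
    have "hom_induced 2 Y {} Y {} (e \<circ> \<phi> h \<circ> d) c
        = hom_induced 2 X {} Y {} e (hom_induced 2 X {} X {} (\<phi> h) (hom_induced 2 Y {} X {} d c))"
      using ec dc \<phi>c by (simp add: hom_induced_compose' continuous_map_compose o_assoc)
    also have "hom_induced 2 X {} X {} (\<phi> h) (hom_induced 2 Y {} X {} d c) = hom_induced 2 Y {} X {} d c"
    proof -
      have "\<forall>c\<in>carrier (homology_group 2 X). hom_induced 2 X {} X {} (\<phi> h) c = c"
        using opres [OF h] unfolding orientation_preserving_homeo_def by (rule conjunct2)
      then show ?thesis using hom_induced_carrier by (rule bspec)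
    qed
    also have "hom_induced 2 X {} Y {} e (hom_induced 2 Y {} X {} d c) = hom_induced 2 Y {} Y {} (e \<circ> d) c"
      using ec dc by (simp add: hom_induced_compose')
    also have "\<dots> = c"
      by (rule hom_induced_id_gen [OF continuous_map_compose [OF dc ec] _ c]) (simp add: ede)
    finally show "hom_induced 2 Y {} Y {} (e \<circ> \<phi> h \<circ> d) c = c" .
  qed
  moreover have "h = \<one>\<^bsub>G\<^esub>" if h: "h \<in> carrier G" and "\<forall>y\<in>topspace Y. (e \<circ> \<phi> h \<circ> d) y = y" for h
  proof (rule faith [OF h], rule ballI)
    fix x assume x: "x \<in> topspace X"
    then have "e (\<phi> h x) = e x" using that(2) eY de by fastforce
    then show "\<phi> h x = x" using de \<phi>X [OF h x] x by metis
  qed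
  moreover have "\<exists>y\<in>topspace Y. (e \<circ> \<phi> h \<circ> d) y = y" if "h \<in> carrier G" for h
  proof -
    obtain x where x: "x \<in> topspace X" "\<phi> h x = x" using fixed [OF \<open>h \<in> carrier G\<close>] by blast
    then have "(e \<circ> \<phi> h \<circ> d) (e x) = e x" by (simp add: de)
    with eY [OF x(1)] show ?thesis by blast
  qed
  ultimately show ?thesis
    unfolding gpnf_action_def orient_pres_faithful_action_def
    using G one mult dX ede de \<phi>X by auto
qed

lemma inj_complex_pair_option_real: "\<exists>e :: (complex \<times> complex) option \<Rightarrow> real. inj e"
proof -
  have pair: "\<exists>p :: real \<times> real \<Rightarrow> real. inj p"
  proof -
    have "(UNIV::real set) \<times> (UNIV::real set) \<approx> (UNIV::real set)"
      unfolding eqpoll_iff_card_of_ordIso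
      by (rule card_of_Times_same_infinite) (simp add: infinite_UNIV_char_0)
    then show ?thesis by (auto simp: eqpoll_def bij_betw_def)
  qed
  then obtain p :: "real \<times> real \<Rightarrow> real" where p: "inj p" by blast
  have p_eq: "p a = p b \<longleftrightarrow> a = b" for a b using p by (rule inj_eq)
  define c where "c z = p (Re z, Im z)" for z
  \<comment> \<open>The first entry 0 or 1 of the outer pair is a tag that keeps \<open>None\<close>
    apart from the points of the curve.\<close>
  define e where "e = (\<lambda>q. case q of None \<Rightarrow> p (0, 0) | Some q \<Rightarrow> p (1, p (c (fst q), c (snd q))))"
  have "inj e"
    by (rule injI) (auto simp: e_def c_def p_eq complex_eq_iff prod_eq_iff split: option.splits)
  then show ?thesis by blast
qed

section \<open>The action on the compactified curve\<close>

context hyperelliptic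
begin

text \<open>Where y is nonzero, x is a local coordinate and y is recovered as a square root.
  Dividing y by its value at \<open>q\<close> moves that value to 1, so the principal branch is the
  right one on the half-plane of positive real part.\<close>

lemma curve_chart_regular:
  assumes q: "q \<in> curve" and nz: "snd q \<noteq> 0"
  shows "\<exists>S (V::complex set). openin (top_of_set curve) S \<and> q \<in> S \<and> open V \<and> top_of_set S homeomorphic_space top_of_set V"
proof -
  let ?b = "snd q"
  let ?f = "\<lambda>x. x * (x ^ (2*g) - 1) / ?b\<^sup>2"
  define S where "S = {r \<in> curve. 0 < Re (snd r / ?b)}"
  define V where "V = {x. ?f x \<notin> \<real>\<^sub>\<le>\<^sub>0}"
  let ?i = "\<lambda>x. (x, ?b * csqrt (?f x))"
  \<comment> \<open>The criterion for \<open>- w\<^sup>2\<close> is applied after multiplication by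
    \<i>, which exchanges real and imaginary axis.\<close>
  have sq: "w\<^sup>2 \<in> \<real>\<^sub>\<le>\<^sub>0 \<longleftrightarrow> Re w = 0" for w :: complex
    using minus_square_nonpos_Reals_iff [of "\<i> * w"] by (simp add: power_mult_distrib)
  have f: "?f (fst r) = (snd r / ?b)\<^sup>2" if "r \<in> curve" for r
    using that by (simp add: hyperelliptic_curve_def power_divide)
  have "open {r::complex \<times> complex. 0 < Re (snd r / ?b)}"
    using nz by (intro open_Collect_less continuous_intros) auto
  moreover have "S = curve \<inter> {r. 0 < Re (snd r / ?b)}" by (auto simp: S_def)
  ultimately have "openin (top_of_set curve) S" by (metis openin_open_Int)
  moreover have "q \<in> S" using q nz by (simp add: S_def)
  moreover have "open V"
  proof -
    have "open (?f -` (- \<real>\<^sub>\<le>\<^sub>0))"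
      using nz by (intro continuous_open_vimage continuous_intros) (auto simp: closed_nonpos_Reals_complex open_Compl)
    moreover have "V = ?f -` (- \<real>\<^sub>\<le>\<^sub>0)" by (auto simp: V_def)
    ultimately show ?thesis by simp
  qed
  moreover have "homeomorphic_maps (top_of_set S) (top_of_set V) fst ?i"
    unfolding homeomorphic_maps_def
  proof (intro conjI ballI)
    have "fst r \<in> V" if "r \<in> S" for r
      using that f [of r] sq by (auto simp: S_def V_def)
    then show "continuous_map (top_of_set S) (top_of_set V) fst"
      by (auto intro!: continuous_intros)
    have "?i x \<in> S" if "x \<in> V" for x
    proof -
      have "Re (csqrt (?f x)) \<noteq> 0"
        using sq [of "csqrt (?f x)"] that by (simp add: V_def)
      then have "0 < Re (csqrt (?f x))" using Re_csqrt [of "?f x"] by linarith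
      then show ?thesis using nz by (simp add: S_def curve_iff power_mult_distrib)
    qed
    moreover have "continuous_on V ?i"
      using nz by (intro continuous_intros continuous_on_csqrt') (auto simp: V_def)
    ultimately show "continuous_map (top_of_set V) (top_of_set S) ?i"
      by auto
    show "?i (fst r) = r" if "r \<in> topspace (top_of_set S)" for r
    proof -
      have r: "r \<in> curve" "0 < Re (snd r / ?b)" using that by (auto simp: S_def)
      then have "csqrt (?f (fst r)) = snd r / ?b" unfolding f [OF r(1)] by (intro csqrt_square) simp
      then show ?thesis using nz by (simp add: prod_eq_iff)
    qed
  qed auto
  then have "top_of_set S homeomorphic_space top_of_set V"
    by (rule homeomorphic_maps_imp_homeomorphic_space)
  ultimately show ?thesis by blast
qed

text \<open>At a zero of y the x-coordinate is a simple zero of the right-hand side, which is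
  therefore locally invertible; y becomes the coordinate and x is the local inverse applied to
  \<open>y\<^sup>2\<close>.\<close>

lemma curve_chart_branch:
  assumes q: "q \<in> curve" and z: "snd q = 0"
  shows "\<exists>S (V::complex set). openin (top_of_set curve) S \<and> q \<in> S \<and> open V \<and> top_of_set S homeomorphic_space top_of_set V"
proof -
  let ?f = "\<lambda>x::complex. x * (x ^ (2*g) - 1)"
  let ?a = "fst q"
  have f0: "?f ?a = 0" using q z by (simp add: hyperelliptic_curve_def)
  have der: "(?f has_field_derivative (?a ^ (2*g) - 1) + ?a * (of_nat (2*g) * ?a ^ (2*g - 1))) (at ?a)"
    by (auto intro!: derivative_eq_intros)
  have "?a * (of_nat (2*g) * ?a ^ (2*g - 1)) = of_nat (2*g) * ?a ^ (2*g)"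
    using g by (simp add: power_eq_if)
  \<comment> \<open>At a zero a, a^(2g) is 0 or 1, so the derivative is -1 at the origin and 2g at
    the roots of unity.\<close>
  then have "deriv ?f ?a = of_nat (2*g + 1) * ?a ^ (2*g) - 1"
    using DERIV_imp_deriv [OF der] by (simp add: algebra_simps)
  moreover have "?a ^ (2*g) = 0 \<or> ?a ^ (2*g) = 1" using f0 g by (auto simp: zero_power)
  ultimately have "deriv ?f ?a = - 1 \<or> deriv ?f ?a = of_nat (2*g)"
    by (elim disjE) (simp_all only: mult_zero_right mult_1_right of_nat_add of_nat_1 diff_0 add_diff_cancel_right' simp_thms)
  then have "deriv ?f ?a \<noteq> 0"
    using g by (elim disjE) simp_all
  moreover have hol: "?f holomorphic_on UNIV" by (intro holomorphic_intros)
  ultimately obtain r where r: "r > 0" "inj_on ?f (ball ?a r)"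
    using has_complex_derivative_locally_injective [of ?f UNIV ?a] by blast
  define W where "W = ball ?a r"
  have cont: "continuous_on W ?f" by (intro continuous_intros)
  have W: "open W" "inj_on ?f W" "?a \<in> W" using r by (auto simp: W_def)
  \<comment> \<open>Invariance of domain supplies a continuous inverse with open domain.\<close>
  obtain k where k: "homeomorphism W (?f ` W) ?f k"
    using invariance_of_domain_homeomorphism [OF W(1) cont _ W(2)] by auto
  have opf: "open (?f ` W)" by (rule invariance_of_domain [OF cont W(1,2)])
  have kf: "k (?f x) = x" if "x \<in> W" for x using k that by (simp add: homeomorphism_def)
  have fk: "?f (k y) = y" "k y \<in> W" if "y \<in> ?f ` W" for y using k that by (auto simp: homeomorphism_def)
  have contk: "continuous_on (?f ` W) k" using k by (simp add: homeomorphism_def)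
  define S where "S = {p \<in> curve. fst p \<in> W}"
  define V where "V = {y. y\<^sup>2 \<in> ?f ` W}"
  let ?i = "\<lambda>y. (k (y\<^sup>2), y)"
  have "open (fst -` W :: (complex \<times> complex) set)" using W(1) by (rule open_vimage_fst)
  moreover have "S = curve \<inter> fst -` W" by (auto simp: S_def)
  ultimately have "openin (top_of_set curve) S" by (metis openin_open_Int)
  moreover have "q \<in> S" using q W by (simp add: S_def)
  moreover have "open V"
  proof -
    have "open ((\<lambda>y. y\<^sup>2) -` (?f ` W))" by (intro continuous_open_vimage opf continuous_intros)
    moreover have "V = (\<lambda>y. y\<^sup>2) -` (?f ` W)" by (auto simp: V_def)
    ultimately show ?thesis by simp
  qed
  moreover have "homeomorphic_maps (top_of_set S) (top_of_set V) snd ?i"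
    unfolding homeomorphic_maps_def
  proof (intro conjI ballI)
    have Sf: "(snd p)\<^sup>2 = ?f (fst p)" "fst p \<in> W" if "p \<in> S" for p
      using that by (auto simp: S_def hyperelliptic_curve_def)
    then have "snd p \<in> V" if "p \<in> S" for p using that by (auto simp: V_def)
    then show "continuous_map (top_of_set S) (top_of_set V) snd"
      by (auto intro!: continuous_intros)
    have "?i y \<in> S" if "y \<in> V" for y
      using fk [of "y\<^sup>2"] that by (simp add: S_def V_def curve_iff)
    moreover have "continuous_on V ?i"
    proof -
      have "continuous_on V (\<lambda>y. k (y\<^sup>2))"
        by (rule continuous_on_compose2 [OF contk]) (auto simp: V_def intro!: continuous_intros)
      then show ?thesis by (intro continuous_intros)
    qed
    ultimately show "continuous_map (top_of_set V) (top_of_set S) ?i" by auto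
    show "?i (snd p) = p" if "p \<in> topspace (top_of_set S)" for p
      using Sf [of p] kf [of "fst p"] that by (simp add: prod_eq_iff)
  qed auto
  then have "top_of_set S homeomorphic_space top_of_set V"
    by (rule homeomorphic_maps_imp_homeomorphic_space)
  ultimately show ?thesis by blast
qed

lemma locally_euclidean_surface: "locally_euclidean_2 surface"
proof (rule locally_euclidean_2_complex_charts)
  fix a assume "a \<in> topspace surface"
  then consider "a = None" | q where "a = Some q" "q \<in> curve" by auto
  then show "\<exists>U. openin surface U \<and> a \<in> U \<and> (\<exists>V::complex set. open V \<and> subtopology surface U homeomorphic_space top_of_set V)"
  proof cases
    case 1
    have "subtopology surface inf_nbhd homeomorphic_space top_of_set (ball (0::complex) 1)"
      using homeomorphic_map_inf_chart homeomorphic_map_imp_homeomorphic_space homeomorphic_space_sym by blast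
    then show ?thesis
      using openin_inf_nbhd 1 by (intro exI [of _ inf_nbhd]) (auto simp: inf_nbhd_def)
  next
    case 2
    obtain S and V :: "complex set" where S: "openin (top_of_set curve) S" "q \<in> S" and V: "open V" "top_of_set S homeomorphic_space top_of_set V"
      using curve_chart_regular [OF 2(2)] curve_chart_branch [OF 2(2)] by blast
    have "S \<subseteq> curve" using openin_subset [OF S(1)] by simp
    then have "homeomorphic_map (top_of_set S) (subtopology surface (Some ` S)) Some"
      using homeomorphic_map_Some [of S "top_of_set curve"] by (simp add: subtopology_subtopology Int_absorb1)
    then have "subtopology surface (Some ` S) homeomorphic_space top_of_set V"
      using V(2) homeomorphic_map_imp_homeomorphic_space homeomorphic_space_sym homeomorphic_space_trans by blast
    then show ?thesis
      using S V(1) 2(1) by (intro exI [of _ "Some ` S"]) auto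
  qed
qed

text \<open>The star part is connected, and a point outside it lies on a band, which is connected
  and meets the star part.\<close>

lemma connected_curve: "connected curve"
proof -
  have 0: "(0, 0) \<in> star_part" using g by (simp add: star_part_def hyperelliptic_curve_def zero_power)
  have subs: "star_part \<subseteq> curve" "band_part \<subseteq> curve"
    by (auto simp: star_part_def band_part_def)
  have star: "connected star_part"
    using contractible_star_part contractible_imp_connected by auto
  have comp: "connected_component curve (0, 0) q" if q: "q \<in> curve" for q
  proof (cases "q \<in> star_part")
    case True
    then show ?thesis using star subs 0 unfolding connected_component_def by blast
  next
    case False
    then have qb: "q \<in> band_part"
      using two_sided_cover_curve(3) q by auto
    define u where "u = band q"
    have u: "u \<in> unity_roots" unfolding u_def by (rule band_in_unity_roots [OF qb])
    define B where "B = band_point ` ({u} \<times> slit_plane)"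
    have "starlike slit_plane" unfolding starlike_def using starlike_slit_planes(1,2) by blast
    then have "connected slit_plane" by (rule starlike_imp_connected)
    then have "connected ({u} \<times> slit_plane)" by (intro connected_Times) auto
    then have conB: "connected B"
      unfolding B_def using u
      by (intro connected_continuous_image continuous_on_subset [OF continuous_on_band_point]) auto
    have "B \<subseteq> curve" using band_point_in_band_part [OF u] subs by (auto simp: B_def)
    have "q \<in> B"
      unfolding B_def using band_point_band_coord [OF qb] band_coord_in [OF qb]
      by (intro image_eqI [of _ _ "band_coord q"]) (auto simp: u_def band_coord_def mem_Times_iff)
    \<comment> \<open>Any point of the band off its cut would serve; this one lies on the upper
      side.\<close>
    have "band_point (u, \<i>/2) \<in> B" using starlike_slit_planes(3) by (auto simp: B_def)
    moreover have "band_point (u, \<i>/2) \<in> upper_band"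
      using starlike_slit_planes(3) band_point_in_band_part [OF u] band_coord_band_point [OF u]
      by (simp add: upper_band_def)
    then have "band_point (u, \<i>/2) \<in> star_part" using two_sided_cover_curve(6) by blast
    ultimately have "connected (star_part \<union> B)"
      using star conB by (intro connected_Un) auto
    then show ?thesis
      using \<open>q \<in> B\<close> \<open>B \<subseteq> curve\<close> 0 subs unfolding connected_component_def by blast
  qed
  show ?thesis
    unfolding connected_iff_connected_component
    using connected_component_trans [OF connected_component_sym [OF comp] comp] by blast
qed

lemma connected_surface: "connected_space surface"
proof -
  have "connectedin surface (inf_chart ` ball 0 1)"
    by (rule connectedin_continuous_map_image [OF continuous_map_inf_chart])
       (simp add: connectedin_subtopology)
  moreover have "connectedin surface (Some ` curve)"
    by (rule connectedin_continuous_map_image [OF continuous_map_Some])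
       (simp add: connectedin_subtopology connected_curve)
  moreover have "inf_point (1/2) \<in> {q \<in> curve. 1 < norm (fst q)}"
    by (rule inf_point_in) auto
  then have "Some (inf_point (1/2)) \<in> inf_nbhd \<inter> Some ` curve"
    by (simp add: inf_nbhd_def)
  ultimately have "connectedin surface (inf_nbhd \<union> Some ` curve)"
    unfolding image_inf_chart by (intro connectedin_Un) auto
  moreover have "inf_nbhd \<union> Some ` curve = topspace surface"
    by (auto simp: inf_nbhd_def)
  ultimately have "connectedin surface (topspace surface)" by (simp only:)
  then show ?thesis by (simp only: connectedin_topspace)
qed

section \<open>The twists by roots of unity and their effect on homology\<close>

definition "twist c q = (c\<^sup>2 * fst q, c * snd q)" for c :: complex and q :: "complex \<times> complex"

lemma twist_in_curve: "c ^ (4*g) = 1 \<Longrightarrow> q \<in> curve \<Longrightarrow> twist c q \<in> curve"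
proof -
  assume c: "c ^ (4*g) = 1" and q: "q \<in> curve"
  have "(c\<^sup>2) ^ (2*g) = 1" using c by (simp flip: power_mult)
  with q show ?thesis
    by (simp add: twist_def hyperelliptic_curve_def power_mult_distrib)
qed

lemma homeomorphic_map_twist:
  assumes c: "c ^ (4*g) = 1"
  shows "homeomorphic_map surface surface (map_option (twist c))"
proof (rule homeomorphic_map_map_option_Alexandroff)
  have "c \<noteq> 0" using c g by (auto simp: zero_power)
  have ci: "(1 / c) ^ (4*g) = 1" using c by (simp add: power_divide)
  have "continuous_on curve (twist c)" for c
    unfolding twist_def by (intro continuous_intros)
  then have "continuous_map (top_of_set curve) (top_of_set curve) (twist c)"
    "continuous_map (top_of_set curve) (top_of_set curve) (twist (1 / c))"
    using twist_in_curve [OF c] twist_in_curve [OF ci] by auto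
  moreover have "twist (1 / c) (twist c q) = q" "twist c (twist (1 / c) q) = q" for q
    using \<open>c \<noteq> 0\<close> by (simp_all add: twist_def power_divide)
  ultimately show "homeomorphic_maps (top_of_set curve) (top_of_set curve) (twist c) (twist (1 / c))"
    unfolding homeomorphic_maps_def by blast
qed

text \<open>In the formula for z the numerator x^g is multiplied by c^(2g) and the denominator y by
  c, while the principal root depends on x^(2g) alone and is unchanged. Hence the rotation factor
  c^(2g-1).\<close>

lemma twist_inf_chart:
  assumes c: "c ^ (4*g) = 1"
  shows "map_option (twist c) (inf_chart z) = inf_chart (c ^ (2*g - 1) * z)"
proof (cases "z = 0")
  case False
  have c0: "c \<noteq> 0" using c g by (auto simp: zero_power)
  define d where "d = c ^ (2*g - 1)"
  have dc: "d * c = c ^ (2*g)" unfolding d_def using g by (simp add: power_eq_if mult.commute)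
  have "(d * c)\<^sup>2 = 1" unfolding dc using c by (simp flip: power_mult)
  then have d2: "d\<^sup>2 = 1 / c\<^sup>2" using c0 by (simp add: power_mult_distrib field_simps)
  have d2g: "d ^ (2*g) = 1 / c ^ (2*g)"
    by (metis d2 power_mult power_one_over)
  have d4g: "d ^ (4*g) = 1"
  proof -
    have "d ^ (4*g) = (c ^ (4*g)) ^ (2*g - 1)" unfolding d_def by (metis power_mult mult.commute)
    then show ?thesis using c by simp
  qed
  have dd: "c * d ^ (2*g+1) = 1"
    using dc c0 d2g by (simp add: mult.commute mult.left_commute)
  have "d \<noteq> 0" using dd by auto
  have "twist c (inf_point z) = inf_point (d * z)"
  proof (rule prod_eqI)
    show "fst (twist c (inf_point z)) = fst (inf_point (d * z))"
      using False c0 by (simp add: twist_def inf_point_def power_mult_distrib d2)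
    have "c / z ^ (2*g+1) = 1 / (d * z) ^ (2*g+1)"
      using dd False \<open>d \<noteq> 0\<close> by (simp add: power_mult_distrib field_simps)
    then show "snd (twist c (inf_point z)) = snd (inf_point (d * z))"
      by (simp add: twist_def inf_point_def power_mult_distrib d4g) (metis mult.commute mult.left_commute times_divide_eq_right mult.right_neutral)
  qed
  then show ?thesis using False \<open>d \<noteq> 0\<close> unfolding d_def [symmetric] by (simp add: inf_chart_def)
qed (simp add: inf_chart_def)

lemma norm_root_of_unity: "c ^ (4*g) = 1 \<Longrightarrow> norm (c::complex) = 1"
  using g by (auto dest: power_eq_1_iff)

lemma surface_minus_inf: "topspace surface - {None} = Some ` curve"
  by auto

lemma homeomorphic_map_Some_curve: "homeomorphic_map (top_of_set curve) (subtopology surface (Some ` curve)) Some"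
  using homeomorphic_map_Some [of curve "top_of_set curve"] by (simp add: subtopology_subtopology)

lemma sheet_swap_first_homology_surface:
  assumes c: "c \<in> carrier (homology_group 1 (subtopology surface (Some ` curve)))"
  shows "hom_induced 1 (subtopology surface (Some ` curve)) {} (subtopology surface (Some ` curve)) {} (map_option (twist (-1))) c
       = inv\<^bsub>homology_group 1 (subtopology surface (Some ` curve))\<^esub> c"
proof -
  let ?C = "top_of_set curve" and ?S = "subtopology surface (Some ` curve)"
  let ?s = "hom_induced 1 ?C {} ?S {} Some"
  let ?f = "map_option (twist (-1))"
  have iso: "?s \<in> iso (homology_group 1 ?C) (homology_group 1 ?S)"
    by (rule homeomorphic_map_homology_iso [OF homeomorphic_map_Some_curve])
  interpret s: group_hom "homology_group 1 ?C" "homology_group 1 ?S" ?s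
    by (rule group_hom_hom_induced)
  have "c \<in> ?s ` carrier (homology_group 1 ?C)"
    using c iso by (simp add: iso_def bij_betw_def)
  then obtain b where b: "b \<in> carrier (homology_group 1 ?C)" and cb: "c = ?s b" by (elim imageE)
  have cS: "continuous_map ?C ?S Some"
    by (rule homeomorphic_imp_continuous_map [OF homeomorphic_map_Some_curve])
  have rot: "(-1) ^ (4*g) = (1::complex)" by simp
  have "continuous_map surface surface ?f"
    by (rule homeomorphic_imp_continuous_map [OF homeomorphic_map_twist [OF rot]])
  then have cf: "continuous_map ?S ?S ?f"
    using twist_in_curve [OF rot] by (auto simp: continuous_map_in_subtopology continuous_map_from_subtopology)
  have csw: "continuous_map ?C ?C sheet_swap"
    by (auto intro!: continuous_intros simp: hyperelliptic_curve_def)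
  have "hom_induced 1 ?S {} ?S {} ?f c = hom_induced 1 ?C {} ?S {} (?f \<circ> Some) b"
    unfolding cb using cS cf by (simp add: hom_induced_compose')
  also have "?f \<circ> Some = Some \<circ> sheet_swap" by (auto simp: twist_def)
  also have "hom_induced 1 ?C {} ?S {} (Some \<circ> sheet_swap) b = ?s (hom_induced 1 ?C {} ?C {} sheet_swap b)"
    using cS csw by (simp add: hom_induced_compose')
  also have "\<dots> = inv\<^bsub>homology_group 1 ?S\<^esub> c"
    unfolding sheet_swap_first_homology_curve [OF b] cb using b by simp
  finally show ?thesis .
qed

text \<open>The twist by -1 plays both parts required at infinity: it is the rotation by (-1)^(2g-1)
  in the disc chart, and it is the sheet swap, hence -1, on \<open>H\<^sub>1\<close> of the
  curve.\<close>

lemma surface_homology_groups: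
  "hom_induced 2 surface {} surface (topspace surface - {None}) id
     \<in> iso (homology_group 2 surface) (relative_homology_group 2 surface (topspace surface - {None}))"
  "homology_group 2 surface \<cong> integer_group"
  "homology_group 1 surface \<cong> free_Abelian_group {..<2*g}"
proof -
  let ?S = "subtopology surface (topspace surface - {None})"
  have "top_of_set curve homeomorphic_space ?S"
    unfolding surface_minus_inf
    using homeomorphic_map_Some_curve homeomorphic_map_imp_homeomorphic_space by blast
  then have iso: "homology_group p (top_of_set curve) \<cong> homology_group p ?S" for p
    by (rule homeomorphic_space_imp_isomorphic_homology_groups)
  have triv: "trivial_group (homology_group 2 ?S)"
    using isomorphic_group_triviality1 [OF iso _ second_homology_curve] by simp
  have "homology_group 1 ?S \<cong> homology_group 1 (top_of_set curve)"
    by (rule group.iso_sym [OF _ iso]) simp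
  then have free: "homology_group 1 ?S \<cong> free_Abelian_group {..<2*g}"
    using first_homology_curve by (rule iso_trans)
  have rot: "(-1) ^ (4*g) = (1::complex)" by simp
  have cont: "continuous_map surface surface (map_option (twist (-1)))"
    by (rule homeomorphic_imp_continuous_map [OF homeomorphic_map_twist [OF rot]])
  have im: "map_option (twist (-1)) \<in> topspace surface - {None} \<rightarrow> topspace surface - {None}"
    using twist_in_curve [OF rot] by auto
  have nrm: "norm ((-1) ^ (2*g - 1) :: complex) = 1" by (simp add: norm_power)
  note * = inf.surface_homology [OF triv free cont im nrm twist_inf_chart [OF rot]
      sheet_swap_first_homology_surface [folded surface_minus_inf]]
  show "hom_induced 2 surface {} surface (topspace surface - {None}) id
     \<in> iso (homology_group 2 surface) (relative_homology_group 2 surface (topspace surface - {None}))"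
  "homology_group 2 surface \<cong> integer_group"
  "homology_group 1 surface \<cong> free_Abelian_group {..<2*g}"
    by (rule *; assumption)+
qed

theorem closed_orientable_surface_compactified_curve: "closed_orientable_surface surface g"
  unfolding closed_orientable_surface_def
  using Hausdorff_surface connected_surface locally_euclidean_surface surface_homology_groups(2,3) by simp

lemma orientation_preserving_twist:
  assumes c: "c ^ (4*g) = 1"
  shows "orientation_preserving_homeo surface (map_option (twist c))"
  unfolding orientation_preserving_homeo_def
proof (intro conjI ballI)
  show hom: "homeomorphic_map surface surface (map_option (twist c))"
    by (rule homeomorphic_map_twist [OF c])
  fix x assume x: "x \<in> carrier (homology_group 2 surface)"
  show "hom_induced 2 surface {} surface {} (map_option (twist c)) x = x"
  proof (rule inf.hom_induced_rotation_trivial [OF _ homeomorphic_imp_continuous_map [OF hom] _ _ twist_inf_chart [OF c] x])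
    show "inj_on (hom_induced 2 surface {} surface (topspace surface - {None}) id) (carrier (homology_group 2 surface))"
      using surface_homology_groups(1) by (simp add: iso_def bij_betw_def)
    show "map_option (twist c) \<in> topspace surface - {None} \<rightarrow> topspace surface - {None}"
      using twist_in_curve [OF c] by auto
    show "norm (c ^ (2*g - 1)) = 1"
      using norm_root_of_unity [OF c] by (simp add: norm_power)
  qed
qed

section \<open>The cyclic group of order 4g and its action\<close>

definition cyclic_group_nat :: "nat monoid" where
  "cyclic_group_nat = \<lparr>carrier = {..<4*g}, monoid.mult = (\<lambda>a b. (a + b) mod (4*g)), one = 0\<rparr>"

definition "zeta = exp (2 * of_real pi * \<i> / of_nat (4*g))"

lemma zeta_power_eq_1_iff: "zeta ^ n = 1 \<longleftrightarrow> 4*g dvd n"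
proof -
  have "zeta ^ n = exp (2 * of_real pi * \<i> * of_nat n / of_nat (4*g))"
    unfolding zeta_def exp_of_nat_mult [symmetric] by (simp add: mult_ac)
  then show ?thesis
    using complex_root_unity_eq_1 [of "4*g" n] g by simp
qed

lemma group_cyclic_group_nat: "group cyclic_group_nat"
proof (rule groupI)
  fix a assume a: "a \<in> carrier cyclic_group_nat"
  show "\<exists>b\<in>carrier cyclic_group_nat. b \<otimes>\<^bsub>cyclic_group_nat\<^esub> a = \<one>\<^bsub>cyclic_group_nat\<^esub>"
    \<comment> \<open>The outer reduction matters for a = 0, where 4g - a falls outside the
      carrier.\<close>
    using a g by (intro bexI [of _ "(4*g - a) mod (4*g)"]) (auto simp: cyclic_group_nat_def mod_simps)
qed (use g in \<open>auto simp: cyclic_group_nat_def mod_simps add.assoc\<close>)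

theorem gpnf_action_surface: "gpnf_action cyclic_group_nat surface (\<lambda>k. map_option (twist (zeta ^ k)))"
proof -
  let ?\<phi> = "\<lambda>k. map_option (twist (zeta ^ k))"
  have z: "(zeta ^ k) ^ (4*g) = 1" for k
    by (simp add: zeta_power_eq_1_iff flip: power_mult)
  have zmod: "zeta ^ ((a + b) mod (4*g)) = zeta ^ a * zeta ^ b" for a b
  proof -
    have "zeta ^ (a + b) = zeta ^ (4*g * ((a + b) div (4*g)) + (a + b) mod (4*g))" by simp
    also have "\<dots> = zeta ^ ((a + b) mod (4*g))"
      unfolding power_add power_mult [of _ "4*g"] using zeta_power_eq_1_iff [of "4*g"] by simp
    finally show ?thesis by (simp add: power_add)
  qed
  have fixed: "(0, 0) \<in> curve" by (simp add: curve_iff)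
  have "k = 0" if k: "k < 4*g" and triv: "\<forall>x\<in>topspace surface. ?\<phi> k x = x" for k
  proof -
    \<comment> \<open>Faithfulness is tested at a point with y nonzero, where c y = y forces c = 1.
      The x-coordinate alone would not exclude c = -1.\<close>
    have "inf_point (1/2) \<in> curve" "1 < norm (fst (inf_point (1/2)))"
      using inf_point_in [of "1/2"] by auto
    then have "twist (zeta ^ k) (inf_point (1/2)) = inf_point (1/2)" "snd (inf_point (1/2)) \<noteq> 0"
      using triv inf_point_inf_coord(4) by auto
    then have "zeta ^ k = 1" by (simp add: twist_def prod_eq_iff)
    then have "4*g dvd k" by (simp add: zeta_power_eq_1_iff)
    with k show ?thesis by (auto dest: dvd_imp_le)
  qed
  moreover have "\<exists>x\<in>topspace surface. ?\<phi> k x = x" for k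
    using fixed by (intro bexI [of _ "Some (0, 0)"]) (auto simp: twist_def)
  moreover have "orientation_preserving_homeo surface (?\<phi> k)" for k
    by (rule orientation_preserving_twist [OF z])
  moreover have "?\<phi> ((a + b) mod (4*g)) x = ?\<phi> a (?\<phi> b x)" for a b x
    by (cases x) (simp_all add: zmod twist_def power_mult_distrib mult.assoc)
  moreover have "?\<phi> 0 x = x" for x
    by (cases x) (simp_all add: twist_def)
  ultimately show ?thesis
    unfolding gpnf_action_def orient_pres_faithful_action_def
    using group_cyclic_group_nat by (simp add: cyclic_group_nat_def)
qed

end

theorem theorem4p9:
  fixes g :: nat
  assumes "g \<ge> 2"
  shows "\<exists>(X :: real topology) (G :: nat monoid) (\<phi> :: nat \<Rightarrow> real \<Rightarrow> real).
           closed_orientable_surface X g \<and> gpnf_action G X \<phi> \<and> order G = 4 * g"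
proof -
  interpret hyperelliptic g using assms by unfold_locales simp
  \<comment> \<open>The compactified curve lives on an option type over pairs of complex numbers,
    whereas the statement asks for a topology on the reals.\<close>
  obtain e :: "(complex \<times> complex) option \<Rightarrow> real" where "inj e"
    using inj_complex_pair_option_real by blast
  then have "inj_on e (topspace surface)" by (rule inj_on_subset) simp
  then obtain X d where ed: "homeomorphic_maps surface (X :: real topology) e d"
    using homeomorphic_maps_pullback_topology by blast
  have "closed_orientable_surface X g"
    using homeomorphic_space_closed_orientable_surface [OF closed_orientable_surface_compactified_curve]
      homeomorphic_maps_imp_homeomorphic_space [OF ed] by blast
  moreover have "order cyclic_group_nat = 4 * g"
    by (simp add: order_def cyclic_group_nat_def)
  ultimately show ?thesis
    using gpnf_action_conjugate [OF gpnf_action_surface ed] by blast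
qed

end
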